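(* Fix integers $K\ge2$ and $\theta\in(0,1)$. Essentially universally optimal mechanisms for histogram sanitization with respect to $\mathbb{L}_1$-distortion exist: there exist a set $\mathcal{H}^n_{\mathrm{ext}}$ and, for each $n$, a $\theta$-DP mechanism $\mathbb{U}^n:\mathcal{H}^n\Rightarrow\mathcal{H}^n_{\mathrm{ext}}$ not depending on $\underline p$, such that for every probability vector $\underline p$ on $K$ elements with all entries positive there are mechanisms $\mathbb{V}^n:\mathcal{H}^n_{\mathrm{ext}}\Rightarrow\mathcal{H}^n$ for which the cascades $\mathbb{W}^n(\underline g|\underline h)=\sum_{\underline b\in\mathcal{H}^n_{\mathrm{ext}}}\mathbb{U}^n(\underline b|\underline h)\mathbb{V}^n(\underline g|\underline b)$ are $\theta$-DP HSMs satisfying $\lim_{n\to\infty}D^n(\mathbb{W}^n,\underline p)=D_K^*(\theta,\underline p)$.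
   Context: Let $\mathcal{H}^n=\{(h_1,\dots,h_K)\in\mathbb{Z}^K: h_k\ge0,\ \sum_k h_k=n\}$; $\underline h,\underline{\hat h}\in\mathcal{H}^n$ are neighboring if $|\underline h-\underline{\hat h}|_1=2$. A mechanism $\mathbb{M}:\mathcal{H}^n\Rightarrow\mathcal{B}$ assigns to each $\underline h\in\mathcal{H}^n$ a pmf $\mathbb{M}(\cdot|\underline h)$ on the set $\mathcal{B}$; it is $\theta$-DP if $\theta\mathbb{M}(b|\underline h)\le\mathbb{M}(b|\underline{\hat h})\le\theta^{-1}\mathbb{M}(b|\underline h)$ for all neighboring $\underline h,\underline{\hat h}$ and all $b\in\mathcal{B}$. A histogram sanitizing mechanism (HSM) is a mechanism $\mathcal{H}^n\Rightarrow\mathcal{H}^n$. Define $D^n(\mathbb{W},\underline p)=\sum_{\underline h,\underline g\in\mathcal{H}^n}\binom{n}{h_1,\dots,h_K}\prod_k p_k^{h_k}\mathbb{W}(\underline g|\underline h)|\underline h-\underline g|_1$, $D^n_*(\theta,\underline p)=\min D^n(\mathbb{W},\underline p)$ over $\theta$-DP HSMs, and $D_K^*(\theta,\underline p)=\lim_{n\to\infty}D^n_*(\theta,\underline p)$. A sequence of $\theta$-DP HSMs $\mathbb{W}^n$ is called essentially universally optimal if each $\mathbb{W}^n$ is a cascade of $\mathbb{U}^n:\mathcal{H}^n\Rightarrow\mathcal{H}^n_{\mathrm{ext}}$ and $\mathbb{V}^n:\mathcal{H}^n_{\mathrm{ext}}\Rightarrow\mathcal{H}^n$ (for some, not necessarily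 finite, set $\mathcal{H}^n_{\mathrm{ext}}$) with $\mathbb{U}^n$ $\theta$-DP and invariant with $\underline p$ (only $\mathbb{V}^n$ may depend on $\underline p$), and $\lim_n D^n(\mathbb{W}^n,\underline p)=D_K^*(\theta,\underline p)$ for every pmf $\underline p$ (with positive entries) on $K$ elements. *)

theory Defs
  imports "HOL-Probability.Probability"
begin

definition hist :: "nat \<Rightarrow> nat \<Rightarrow> (nat \<Rightarrow> nat) set" where
  "hist K n = {h. (\<forall>k\<ge>K. h k = 0) \<and> (\<Sum>k<K. h k) = n}"

definition l1 :: "nat \<Rightarrow> (nat \<Rightarrow> nat) \<Rightarrow> (nat \<Rightarrow> nat) \<Rightarrow> real" where
  "l1 K h g = (\<Sum>k<K. \<bar>real (h k) - real (g k)\<bar>)"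

definition neighboring :: "nat \<Rightarrow> (nat \<Rightarrow> nat) \<Rightarrow> (nat \<Rightarrow> nat) \<Rightarrow> bool" where
  "neighboring K h g \<longleftrightarrow> l1 K h g = 2"

definition is_DP :: "nat \<Rightarrow> nat \<Rightarrow> real \<Rightarrow> ((nat \<Rightarrow> nat) \<Rightarrow> 'b pmf) \<Rightarrow> bool" where
  "is_DP K n \<theta> M \<longleftrightarrow>
     (\<forall>h\<in>hist K n. \<forall>g\<in>hist K n. neighboring K h g \<longrightarrow>
        (\<forall>b. \<theta> * pmf (M h) b \<le> pmf (M g) b \<and> pmf (M g) b \<le> pmf (M h) b / \<theta>))"

definition is_HSM :: "nat \<Rightarrow> nat \<Rightarrow> ((nat \<Rightarrow> nat) \<Rightarrow> (nat \<Rightarrow> nat) pmf) \<Rightarrow> bool" where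
  "is_HSM K n W \<longleftrightarrow> (\<forall>h\<in>hist K n. set_pmf (W h) \<subseteq> hist K n)"

definition multinom :: "nat \<Rightarrow> nat \<Rightarrow> (nat \<Rightarrow> nat) \<Rightarrow> real" where
  "multinom K n h = fact n / (\<Prod>k<K. fact (h k))"

definition distortion :: "nat \<Rightarrow> nat \<Rightarrow> ((nat \<Rightarrow> nat) \<Rightarrow> (nat \<Rightarrow> nat) pmf) \<Rightarrow> (nat \<Rightarrow> real) \<Rightarrow> real" where
  "distortion K n W p =
     (\<Sum>h\<in>hist K n. \<Sum>g\<in>hist K n.
        multinom K n h * (\<Prod>k<K. p k ^ h k) * pmf (W h) g * l1 K h g)"

definition opt_distortion :: "nat \<Rightarrow> nat \<Rightarrow> real \<Rightarrow> (nat \<Rightarrow> real) \<Rightarrow> real" where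
  "opt_distortion K n \<theta> p =
     Inf {distortion K n W p | W. is_HSM K n W \<and> is_DP K n \<theta> W}"

definition lim_opt_distortion :: "nat \<Rightarrow> real \<Rightarrow> (nat \<Rightarrow> real) \<Rightarrow> real" where
  "lim_opt_distortion K \<theta> p = lim (\<lambda>n. opt_distortion K n \<theta> p)"

definition is_prob_vec :: "nat \<Rightarrow> (nat \<Rightarrow> real) \<Rightarrow> bool" where
  "is_prob_vec K p \<longleftrightarrow> (\<forall>k<K. p k > 0) \<and> (\<Sum>k<K. p k) = 1"

end

theory Submission
  imports Defs "HOL-Real_Asymp.Real_Asymp"
begin

text \<open>
  Adding to the histogram a noise distributed on the lattice of integer vectors with coordinate
  sum 0 is \<open>\<theta>\<close>-DP when the noise probabilities of neighbouring lattice points differ by a factor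
  of at most \<open>1/\<theta>\<close>. Let \<open>C\<close> be the infimum of the expected \<open>L\<^sub>1\<close>-norm over all such noises. Then the
  limit of the optimal distortion is \<open>C\<close> for every \<open>p\<close>, and additive noise, which knows nothing of
  \<open>p\<close>, attains it; no formula for \<open>C\<close> is needed.

  Upper bound: use noises of cost tending to \<open>C\<close>, and send outcomes with negative entries to a
  nearest histogram. As all entries of a typical histogram grow with \<open>n\<close>, this correction
  is asymptotically free, provided the noises are chosen to approach \<open>C\<close> slowly enough.

  Lower bound: the column \<open>h \<mapsto> W(g|h)\<close> of any \<open>\<theta>\<close>-DP mechanism, recentred at \<open>g\<close>, satisfies the same
  constraint as a noise. Restricted to a ball it extends to the whole lattice, and for a suitable
  radius the extension adds little cost, so that its mean norm is at least about \<open>C\<close>. Since the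
  multinomial distribution is asymptotically invariant under a fixed lattice shift, summing over \<open>g\<close>
  bounds the distortion from below by \<open>C\<close> up to \<open>o(1)\<close>.
\<close>

section \<open>The lattice of histogram differences\<close>

text \<open>The L1-norm, with values in \<open>nat\<close> so that it can serve as an exponent and
  as an induction measure.\<close>

definition nrm :: "nat \<Rightarrow> (nat \<Rightarrow> int) \<Rightarrow> nat" where
  "nrm K x = (\<Sum>k<K. nat \<bar>x k\<bar>)"

text \<open>The root lattice of type A of rank \<open>K - 1\<close>. Its roots are the vectors of
  norm 2, so neighbouring histograms differ exactly by a root.\<close>

definition root_lattice :: "nat \<Rightarrow> (nat \<Rightarrow> int) set" where
  "root_lattice K = {x. (\<forall>k\<ge>K. x k = 0) \<and> (\<Sum>k<K. x k) = 0}"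

lemma nrm_zero [simp]: "nrm K (\<lambda>_. 0) = 0"
  by (simp add: nrm_def)

lemma nrm_diff_commute: "nrm K (x - y) = nrm K (y - x)"
  by (simp add: nrm_def abs_minus_commute)

lemma nrm_triangle: "nrm K (x - z) \<le> nrm K (x - y) + nrm K (y - z)"
  unfolding nrm_def sum.distrib [symmetric] by (intro sum_mono) auto

lemma nrm_le_nrm_diff_add: "nrm K x \<le> nrm K (x - y) + nrm K y"
  unfolding nrm_def sum.distrib [symmetric] by (intro sum_mono) auto

lemma abs_le_nrm: "k < K \<Longrightarrow> \<bar>x k\<bar> \<le> int (nrm K x)"
  unfolding nrm_def using member_le_sum [of k "{..<K}" "\<lambda>k. nat \<bar>x k\<bar>"]
  by (auto simp del: of_nat_sum)

lemma root_lattice_diff: "x \<in> root_lattice K \<Longrightarrow> y \<in> root_lattice K \<Longrightarrow> x - y \<in> root_lattice K"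
  by (auto simp: root_lattice_def sum_subtractf)

lemma bij_betw_lattice_diff:
  assumes "z \<in> root_lattice K"
  shows "bij_betw (\<lambda>x. x - z) (root_lattice K) (root_lattice K)"
proof (rule bij_betw_byWitness [where f' = "\<lambda>x. x - (- z)"])
  have "- z \<in> root_lattice K"
    using assms by (auto simp: root_lattice_def sum_negf)
  then show "(\<lambda>x. x - - z) ` root_lattice K \<subseteq> root_lattice K"
    by (auto intro!: root_lattice_diff)
qed (use assms in \<open>auto intro!: root_lattice_diff simp: fun_eq_iff\<close>)

lemma sum_power_abs_int:
  fixes t :: real
  shows "(\<Sum>j\<in>{- int M..int M}. t ^ nat \<bar>j\<bar>) = 2 * (\<Sum>i<Suc M. t ^ i) - 1"
proof (induction M)
  case (Suc M)
  have "{- int (Suc M)..int (Suc M)} = insert (int (Suc M)) (insert (- int (Suc M)) {- int M..int M})"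
    by auto
  moreover have "(\<Sum>j\<in>insert (int (Suc M)) (insert (- int (Suc M)) {- int M..int M}). t ^ nat \<bar>j\<bar>)
      = 2 * t ^ Suc M + (\<Sum>j\<in>{- int M..int M}. t ^ nat \<bar>j\<bar>)"
    by (simp add: nat_add_distrib)
  ultimately show ?case
    using Suc by (simp add: algebra_simps)
qed auto

text \<open>The power of the norm factorises over the coordinates. Enlarging \<open>F\<close> to a
  full box and dropping the zero-sum condition leaves a product of \<open>K\<close> two-sided
  geometric sums.\<close>

lemma sum_power_nrm_le:
  fixes t :: real
  assumes t: "0 \<le> t" "t < 1" and F: "finite F" "F \<subseteq> root_lattice K"
  shows "(\<Sum>x\<in>F. t ^ nrm K x) \<le> (2 / (1 - t)) ^ K"
proof -
  \<comment> \<open>A crude bound for every coordinate of every point of \<open>F\<close>; the final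
    estimate does not depend on it.\<close>
  define M where "M = (\<Sum>x\<in>F. nrm K x)"
  have M: "x k \<in> {- int M..int M}" if "x \<in> F" "k < K" for x k
    using abs_le_nrm [OF that(2), of x] member_le_sum [of x F "nrm K"] that F
    by (auto simp: M_def simp del: of_nat_sum)
  \<comment> \<open>Restriction moves the points into the extensional product \<open>PiE\<close>; it
    loses nothing because lattice points vanish from \<open>K\<close> on.\<close>
  have inj: "inj_on (\<lambda>x. restrict x {..<K}) F"
  proof (rule inj_onI)
    fix x y assume xy: "x \<in> F" "y \<in> F" "restrict x {..<K} = restrict y {..<K}"
    show "x = y"
    proof
      fix k show "x k = y k"
        using fun_cong [OF xy(3), of k] subsetD [OF F(2) xy(1)] subsetD [OF F(2) xy(2)]
        by (cases "k < K") (auto simp: root_lattice_def)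
    qed
  qed
  have geo: "(\<Sum>j\<in>{- int M..int M}. t ^ nat \<bar>j\<bar>) \<le> 2 / (1 - t)"
  proof -
    have "(\<Sum>i<Suc M. t ^ i) \<le> 1 / (1 - t)"
      using t by (subst sum_gp_strict) (auto simp: divide_right_mono)
    then show ?thesis
      unfolding sum_power_abs_int by simp
  qed
  have "(\<Sum>x\<in>F. t ^ nrm K x) = (\<Sum>x\<in>F. \<Prod>k<K. t ^ nat \<bar>restrict x {..<K} k\<bar>)"
    by (simp add: nrm_def power_sum)
  also have "\<dots> = (\<Sum>y\<in>(\<lambda>x. restrict x {..<K}) ` F. \<Prod>k<K. t ^ nat \<bar>y k\<bar>)"
    by (simp only: sum.reindex [OF inj] o_def)
  also have "\<dots> \<le> (\<Sum>y\<in>PiE {..<K} (\<lambda>_. {- int M..int M}). \<Prod>k<K. t ^ nat \<bar>y k\<bar>)"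
    using M t by (intro sum_mono2) (auto intro!: finite_PiE prod_nonneg split: if_splits)
  also have "\<dots> = (\<Prod>k<K. \<Sum>j\<in>{- int M..int M}. t ^ nat \<bar>j\<bar>)"
    by (subst prod_sum_PiE) auto
  also have "\<dots> \<le> (\<Prod>k<K. 2 / (1 - t))"
    using geo t by (intro prod_mono) (auto intro!: sum_nonneg)
  finally show ?thesis by simp
qed

lemma summable_on_power_nrm:
  fixes t :: real
  assumes "0 \<le> t" "t < 1"
  shows "(\<lambda>x. t ^ nrm K x) summable_on root_lattice K"
  using sum_power_nrm_le [OF assms] assms
  by (intro nonneg_bdd_above_summable_on) (auto intro!: bdd_aboveI2)

text \<open>Half of the decay, a factor \<open>sqrt s\<close> per unit of norm, absorbs the linear
  growth; the other half remains summable.\<close>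

lemma summable_on_power_nrm_mult:
  fixes s :: real
  assumes "0 < s" "s < 1"
  shows "(\<lambda>x. s ^ nrm K x * (real (nrm K x) + 1)) summable_on root_lattice K"
proof -
  define t where "t = sqrt s"
  have t: "0 < t" "t < 1" "t * t = s"
    using assms by (auto simp: t_def)
  have "(\<lambda>n. t ^ n * (real n + 1)) \<longlonglongrightarrow> 0"
    using tendsto_add [OF powser_times_n_limit_0 [of t] LIMSEQ_power_zero [of t]] t
    by (simp add: algebra_simps)
  then have "Bseq (\<lambda>n. t ^ n * (real n + 1))"
    using convergentI convergent_imp_Bseq by blast
  then obtain B where B: "\<And>n. norm (t ^ n * (real n + 1)) \<le> B"
    by (auto simp: Bseq_def)
  have "s ^ n * (real n + 1) \<le> B * t ^ n" for n
  proof -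
    have "s ^ n * (real n + 1) = t ^ n * (t ^ n * (real n + 1))"
      by (simp flip: t(3) add: power_mult_distrib)
    also have "\<dots> \<le> t ^ n * B"
      using B [of n] t by (intro mult_left_mono) auto
    finally show ?thesis by (simp add: mult.commute)
  qed
  moreover have "(\<lambda>x. B * t ^ nrm K x) summable_on root_lattice K"
    using t by (intro summable_on_cmult_right summable_on_power_nrm) auto
  ultimately show ?thesis
    using assms by (elim summable_on_comparison_test) auto
qed

section \<open>Optimal noise\<close>

text \<open>One inequality suffices, since exchanging \<open>x\<close> and \<open>y\<close> gives
  the other. Integrability is demanded because the expectation of a non-integrable function is 0 by
  convention, so that heavy-tailed noise would count as free.\<close>

definition noise :: "nat \<Rightarrow> real \<Rightarrow> (nat \<Rightarrow> int) pmf set" where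
  "noise K \<theta> = {N. set_pmf N \<subseteq> root_lattice K \<and>
     (\<forall>x\<in>root_lattice K. \<forall>y\<in>root_lattice K. nrm K (x - y) = 2 \<longrightarrow> \<theta> * pmf N x \<le> pmf N y) \<and>
     integrable (measure_pmf N) (\<lambda>x. real (nrm K x))}"

definition noise_cost :: "nat \<Rightarrow> real \<Rightarrow> real" where
  "noise_cost K \<theta> =
     Inf ((\<lambda>N. measure_pmf.expectation N (\<lambda>x. real (nrm K x))) ` noise K \<theta>)"

lemma noise_cost_le:
  "N \<in> noise K \<theta> \<Longrightarrow> noise_cost K \<theta> \<le> measure_pmf.expectation N (\<lambda>x. real (nrm K x))"
  unfolding noise_cost_def by (intro cInf_lower bdd_belowI2 [where m = 0]) auto

lemma summable_on_iff_abs_summable_on_infsetsum: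
  fixes f :: "'a \<Rightarrow> real"
  shows "f summable_on A \<longleftrightarrow> Infinite_Set_Sum.abs_summable_on f A"
  by (rule trans [OF summable_on_iff_abs_summable_on_real abs_summable_equivalent])

lemma integrable_measure_pmf_iff_summable_on:
  fixes f :: "'a \<Rightarrow> real"
  shows "integrable (measure_pmf N) f \<longleftrightarrow> (\<lambda>x. pmf N x * f x) summable_on UNIV"
  unfolding summable_on_iff_abs_summable_on_infsetsum
    Infinite_Set_Sum.abs_summable_on_def measure_pmf_eq_density
  by (subst integrable_density) auto

lemma expectation_eq_infsum:
  fixes f :: "'a \<Rightarrow> real"
  assumes "integrable (measure_pmf N) f"
  shows "measure_pmf.expectation N f = infsum (\<lambda>x. pmf N x * f x) UNIV"
  using assms
  by (simp add: pmf_expectation_eq_infsetsum infsetsum_infsum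
      integrable_measure_pmf_iff_summable_on summable_on_iff_abs_summable_on_infsetsum)

text \<open>The privacy constraint is homogeneous and survives division by the total mass; the mean
  norm becomes the ratio of first moment to mass.\<close>

lemma noise_of_profile:
  fixes f :: "(nat \<Rightarrow> int) \<Rightarrow> real"
  assumes nonneg: "\<And>x. x \<in> root_lattice K \<Longrightarrow> 0 \<le> f x"
    and DP: "\<And>x y. \<lbrakk>x \<in> root_lattice K; y \<in> root_lattice K; nrm K (x - y) = 2\<rbrakk> \<Longrightarrow> \<theta> * f x \<le> f y"
    and summable: "f summable_on root_lattice K" "(\<lambda>x. f x * real (nrm K x)) summable_on root_lattice K"
    and pos: "0 < infsum f (root_lattice K)"
  obtains N where "N \<in> noise K \<theta>"
    "measure_pmf.expectation N (\<lambda>x. real (nrm K x)) =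
       infsum (\<lambda>x. f x * real (nrm K x)) (root_lattice K) / infsum f (root_lattice K)"
proof -
  define F where "F = infsum f (root_lattice K)"
  define g where "g x = (if x \<in> root_lattice K then f x / F else 0)" for x
  have F: "0 < F" using pos by (simp add: F_def)
  have "(\<lambda>x. f x * (1 / F)) summable_on root_lattice K"
    by (intro summable_on_cmult_left summable)
  then have g_summable: "g summable_on UNIV"
    by (subst summable_on_cong_neutral [where T = "root_lattice K" and g = "\<lambda>x. f x * (1 / F)"])
      (auto simp: g_def)
  have "infsum g UNIV = infsum (\<lambda>x. f x * (1 / F)) (root_lattice K)"
    by (intro infsum_cong_neutral) (auto simp: g_def)
  also have "\<dots> = F * (1 / F)"
    unfolding F_def by (rule infsum_cmult_left')
  finally have g_sum: "infsum g UNIV = 1"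
    using F by simp
  have g_nonneg: "0 \<le> g x" for x
    using nonneg F by (auto simp: g_def)
  have "Infinite_Set_Sum.abs_summable_on g UNIV"
    using g_summable by (simp add: summable_on_iff_abs_summable_on_infsetsum)
  then have "(\<integral>\<^sup>+ x. ennreal (g x) \<partial>count_space UNIV) = 1"
    using g_nonneg g_sum by (subst nn_integral_conv_infsetsum) (auto simp: infsetsum_infsum)
  then have pmf_N: "pmf (embed_pmf g) x = g x" for x
    using g_nonneg by (intro pmf_embed_pmf) auto
  have "(\<lambda>x. f x * real (nrm K x) * (1 / F)) summable_on root_lattice K"
    by (intro summable_on_cmult_left summable)
  then have "(\<lambda>x. g x * real (nrm K x)) summable_on UNIV"
    by (subst summable_on_cong_neutral
        [where T = "root_lattice K" and g = "\<lambda>x. f x * real (nrm K x) * (1 / F)"]) (auto simp: g_def)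
  then have int: "integrable (measure_pmf (embed_pmf g)) (\<lambda>x. real (nrm K x))"
    by (simp add: integrable_measure_pmf_iff_summable_on pmf_N)
  have "\<theta> * g x \<le> g y" if "x \<in> root_lattice K" "y \<in> root_lattice K" "nrm K (x - y) = 2" for x y
    using divide_right_mono [OF DP [OF that], of F] that F by (simp add: g_def)
  then have "embed_pmf g \<in> noise K \<theta>"
    using int by (auto simp: noise_def pmf_N set_pmf_eq) (auto simp: g_def split: if_splits)
  moreover have "measure_pmf.expectation (embed_pmf g) (\<lambda>x. real (nrm K x)) =
      infsum (\<lambda>x. f x * real (nrm K x)) (root_lattice K) / F"
  proof -
    have "infsum (\<lambda>x. g x * real (nrm K x)) UNIV =
        infsum (\<lambda>x. f x * real (nrm K x) * (1 / F)) (root_lattice K)"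
      by (intro infsum_cong_neutral) (auto simp: g_def)
    also have "\<dots> = infsum (\<lambda>x. f x * real (nrm K x)) (root_lattice K) * (1 / F)"
      by (rule infsum_cmult_left')
    finally show ?thesis
      by (simp add: expectation_eq_infsum [OF int] pmf_N)
  qed
  ultimately show thesis
    using that unfolding F_def by blast
qed

text \<open>A step between neighbours changes the norm by at most 2, so the geometric profile with
  ratio \<open>sqrt \<theta>\<close> loses at most the factor \<theta>.\<close>

lemma noise_nonempty:
  assumes "0 < \<theta>" "\<theta> < 1"
  shows "noise K \<theta> \<noteq> {}"
proof -
  define s where "s = sqrt \<theta>"
  have s: "0 < s" "s < 1" "s\<^sup>2 = \<theta>"
    using assms by (auto simp: s_def)
  have summable: "(\<lambda>x. s ^ nrm K x) summable_on root_lattice K"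
    using s by (intro summable_on_power_nrm) auto
  show ?thesis
  proof (rule noise_of_profile [of K "\<lambda>x. s ^ nrm K x" \<theta>])
    fix x y assume "nrm K (x - y) = 2"
    then have "nrm K y \<le> 2 + nrm K x"
      using nrm_le_nrm_diff_add [of K y x] by (simp add: nrm_diff_commute)
    then have "s ^ (2 + nrm K x) \<le> s ^ nrm K y"
      using s by (intro power_decreasing) auto
    then show "\<theta> * s ^ nrm K x \<le> s ^ nrm K y"
      by (simp only: power_add s(3))
  next
    show "(\<lambda>x. s ^ nrm K x * real (nrm K x)) summable_on root_lattice K"
      by (rule summable_on_comparison_test [OF summable_on_power_nrm_mult [OF s(1,2)]])
        (use s in \<open>auto intro!: mult_left_mono\<close>)
    have "(\<lambda>_. 0) \<in> root_lattice K" by (auto simp: root_lattice_def)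
    then have "infsum (\<lambda>x. s ^ nrm K x) {\<lambda>_. 0} \<le> infsum (\<lambda>x. s ^ nrm K x) (root_lattice K)"
      using s(1) summable by (intro infsum_mono2) auto
    then show "0 < infsum (\<lambda>x. s ^ nrm K x) (root_lattice K)"
      by simp
  qed (use s summable in auto)
qed

lemma noise_cost_nonneg:
  assumes "0 < \<theta>" "\<theta> < 1"
  shows "0 \<le> noise_cost K \<theta>"
  unfolding noise_cost_def using noise_nonempty [OF assms] by (intro cInf_greatest) auto

text \<open>Homogeneous form of \<open>noise_cost_le\<close>: free of normalisation, hence valid for
  profiles of mass 0 as well.\<close>

lemma noise_cost_le_profile:
  fixes f :: "(nat \<Rightarrow> int) \<Rightarrow> real"
  assumes nonneg: "\<And>x. x \<in> root_lattice K \<Longrightarrow> 0 \<le> f x"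
    and DP: "\<And>x y. \<lbrakk>x \<in> root_lattice K; y \<in> root_lattice K; nrm K (x - y) = 2\<rbrakk> \<Longrightarrow> \<theta> * f x \<le> f y"
    and summable: "f summable_on root_lattice K" "(\<lambda>x. f x * real (nrm K x)) summable_on root_lattice K"
  shows "noise_cost K \<theta> * infsum f (root_lattice K) \<le> infsum (\<lambda>x. f x * real (nrm K x)) (root_lattice K)"
proof (cases "infsum f (root_lattice K) = 0")
  case True
  then show ?thesis
    using nonneg by (auto intro!: infsum_nonneg)
next
  case False
  then have pos: "0 < infsum f (root_lattice K)"
    using infsum_nonneg [of "root_lattice K" f] nonneg by force
  obtain N where "N \<in> noise K \<theta>"
    "measure_pmf.expectation N (\<lambda>x. real (nrm K x)) =
       infsum (\<lambda>x. f x * real (nrm K x)) (root_lattice K) / infsum f (root_lattice K)"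
    using noise_of_profile [OF nonneg DP summable pos] by blast
  then show ?thesis
    using noise_cost_le [of N K \<theta>] pos by (simp add: pos_le_divide_eq)
qed

section \<open>Localising the cost bound to a ball of the lattice\<close>

definition lball :: "nat \<Rightarrow> nat \<Rightarrow> (nat \<Rightarrow> int) set" where
  "lball K r = {x \<in> root_lattice K. nrm K x < r}"

text \<open>Neighbouring points differ by at most 2 in norm, so a step out of a ball starts in its
  outermost shell of width 2.\<close>

definition lshell :: "nat \<Rightarrow> nat \<Rightarrow> (nat \<Rightarrow> int) set" where
  "lshell K j = {x \<in> root_lattice K. 2 * j \<le> nrm K x \<and> nrm K x < 2 * j + 2}"

text \<open>Counting by weight: each point of the ball weighs at least \<open>(1/2) ^ r\<close>,
  while any finite set of lattice points weighs at most \<open>4 ^ K\<close> in total.\<close>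

lemma finite_lball [simp]: "finite (lball K r)"
proof -
  have "card F \<le> nat \<lceil>4 ^ K * 2 ^ r :: real\<rceil>" if F: "F \<subseteq> lball K r" "finite F" for F
  proof -
    have "real (card F) * (1/2) ^ r \<le> (\<Sum>x\<in>F. (1/2) ^ nrm K x)"
      using F(1) by (intro sum_bounded_below power_decreasing) (auto simp: lball_def)
    also have "\<dots> \<le> 4 ^ K"
      using sum_power_nrm_le [of "1/2" F K] F by (auto simp: lball_def)
    finally have "real (card F) \<le> 4 ^ K * 2 ^ r"
      by (simp add: field_simps)
    then show ?thesis by linarith
  qed
  then show ?thesis
    by (meson finite_if_finite_subsets_card_bdd)
qed

lemma finite_lshell [simp]: "finite (lshell K j)"
  by (rule finite_subset [OF _ finite_lball [of K "2 * j + 2"]]) (auto simp: lshell_def lball_def)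

lemma has_sum_finite_sum:
  fixes f :: "'i \<Rightarrow> 'a \<Rightarrow> real"
  assumes "finite I" "\<And>i. i \<in> I \<Longrightarrow> (f i has_sum S i) A"
  shows "((\<lambda>x. \<Sum>i\<in>I. f i x) has_sum (\<Sum>i\<in>I. S i)) A"
  using assms by (induction I rule: finite_induct) (auto intro!: has_sum_add)

text \<open>A profile known on a ball is continued by its largest admissible values on the outer shell;
  the cost of the continuation is controlled by the mass on that shell.\<close>

lemma ball_profile_cost:
  fixes c :: "(nat \<Rightarrow> int) \<Rightarrow> real"
  assumes \<theta>: "0 < \<theta>" "\<theta> < 1"
    and nonneg: "\<And>x. x \<in> lball K (2 * j + 2) \<Longrightarrow> 0 \<le> c x"
    and lip: "\<And>x y. \<lbrakk>x \<in> lball K (2 * j + 2); y \<in> lball K (2 * j + 2)\<rbrakk>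
      \<Longrightarrow> sqrt \<theta> ^ nrm K (x - y) * c y \<le> c x"
  shows "- ((\<Sum>z\<in>lshell K j. c z) * (2 * j + 2) *
        infsum (\<lambda>x. sqrt \<theta> ^ nrm K x * (real (nrm K x) + 1)) (root_lattice K))
      \<le> (\<Sum>x\<in>lball K (2 * j + 2). c x * (real (nrm K x) - noise_cost K \<theta>))"
proof -
  define s where "s = sqrt \<theta>"
  have s: "0 < s" "s < 1" and s2: "s\<^sup>2 = \<theta>"
    using \<theta> by (auto simp: s_def)
  define B where "B = lball K (2 * j + 2)"
  define S where "S = lshell K j"
  define Out where "Out = root_lattice K - B"
  \<comment> \<open>The values forced at \<open>x\<close> by the shell points. The extra 0 keeps the
    maximum defined and nonnegative when the shell is empty.\<close>
  define T where "T x = insert 0 ((\<lambda>z. s ^ nrm K (x - z) * c z) ` S)" for x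
  define f where "f x = (if x \<in> B then c x else Max (T x))" for x
  \<comment> \<open>\<open>u\<close> will be a summable majorant of
    \<open>f x * real (nrm K x)\<close> outside the ball, with one translate of \<open>w\<close> for
    each shell point.\<close>
  define w where "w x = s ^ nrm K x * (real (nrm K x) + 1)" for x
  define u where "u x = (\<Sum>z\<in>S. c z * (2 * j + 2) * w (x - z))" for x
  have fin [simp]: "finite B" "finite S" "finite (T x)" for x
    by (auto simp: B_def S_def T_def)
  have SB: "S \<subseteq> B" by (auto simp: S_def B_def lball_def lshell_def)
  have BL: "B \<subseteq> root_lattice K" by (auto simp: B_def lball_def)
  have cB: "0 \<le> c x" if "x \<in> B" for x
    using nonneg that by (auto simp: B_def)
  have lipB: "s ^ nrm K (x - y) * c y \<le> c x" if "x \<in> B" "y \<in> B" for x y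
    using lip that by (auto simp: B_def s_def)
  have T_le: "s ^ nrm K (x - z) * c z \<le> Max (T x)" if "z \<in> S" for x z
    using that by (intro Max_ge) (auto simp: T_def)
  have T_nonneg: "0 \<le> Max (T x)" for x
    by (intro Max_ge) (auto simp: T_def)
  have f_nonneg: "0 \<le> f x" for x
    using T_nonneg cB by (auto simp: f_def)
  have shrink: "\<theta> * s ^ nrm K (x - z) \<le> s ^ nrm K (y - z)" if "nrm K (x - y) = 2" for x y z
  proof -
    have "nrm K (y - z) \<le> 2 + nrm K (x - z)"
      using nrm_triangle [of K y z x] that by (simp add: nrm_diff_commute)
    then have "s ^ (2 + nrm K (x - z)) \<le> s ^ nrm K (y - z)"
      using s by (intro power_decreasing) auto
    then show ?thesis by (simp only: power_add s2)
  qed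
  have inner: "x \<in> S" if "x \<in> B" "y \<in> Out" "nrm K (y - x) = 2" for x y
    using that nrm_le_nrm_diff_add [of K y x]
    by (auto simp: B_def S_def Out_def lball_def lshell_def)
  have f_DP: "\<theta> * f x \<le> f y" if xy: "x \<in> root_lattice K" "y \<in> root_lattice K" "nrm K (x - y) = 2" for x y
  proof (cases "x \<in> B")
    case True
    show ?thesis
    proof (cases "y \<in> B")
      case y: True
      have "\<theta> * c x \<le> c y"
        using lipB [OF y True] xy(3) by (simp add: nrm_diff_commute s2)
      then show ?thesis
        using True y by (simp add: f_def)
    next
      case False
      then have "x \<in> S"
        using inner [OF True, of y] xy by (simp add: Out_def nrm_diff_commute)
      then show ?thesis
        using T_le [of x y] True False xy(3) by (simp add: f_def nrm_diff_commute s2)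
    qed
  next
    case False
    \<comment> \<open>A shell point \<open>z\<close> that attains the maximum at \<open>x\<close>
      also bounds \<open>f y\<close> from below: through \<open>T y\<close> if \<open>y\<close> is
      outside the ball, through the hypothesis on \<open>c\<close> if it is inside.\<close>
    have "Max (T x) \<in> T x"
      by (intro Max_in) (auto simp: T_def)
    then consider "Max (T x) = 0" | z where "z \<in> S" "Max (T x) = s ^ nrm K (x - z) * c z"
      by (auto simp: T_def)
    then show ?thesis
    proof cases
      case 1
      then show ?thesis
        using False f_nonneg [of y] by (simp add: f_def)
    next
      case 2
      have "\<theta> * Max (T x) \<le> s ^ nrm K (y - z) * c z"
        using mult_right_mono [OF shrink [OF xy(3), of z] cB [of z]] 2 SB by (auto simp: mult.assoc)
      also have "\<dots> \<le> f y"
        using T_le [OF 2(1), of y] lipB [of y z] 2(1) SB by (auto simp: f_def)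
      finally show ?thesis
        using False by (simp add: f_def)
    qed
  qed
  have w_nonneg: "0 \<le> w x" for x
    using s by (auto simp: w_def)
  have f_le: "f x \<le> f x * real (nrm K x)" and f_nrm_le: "f x * real (nrm K x) \<le> u x"
    if x: "x \<in> Out" for x
  proof -
    \<comment> \<open>The ball has radius at least 2. Hence outside it the mass is dominated by the
      first moment, and summability of the moment gives that of \<open>f\<close>.\<close>
    have "1 \<le> real (nrm K x)"
      using x by (auto simp: Out_def B_def lball_def)
    then show "f x \<le> f x * real (nrm K x)"
      using f_nonneg [of x] by (simp add: mult_le_cancel_left1)
    have u_nonneg: "0 \<le> u x"
      using cB SB w_nonneg unfolding u_def by (intro sum_nonneg mult_nonneg_nonneg) auto
    have "Max (T x) \<in> T x"
      by (intro Max_in) (auto simp: T_def)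
    then consider "f x = 0" | z where "z \<in> S" "f x = s ^ nrm K (x - z) * c z"
      using x by (auto simp: T_def f_def Out_def)
    then show "f x * real (nrm K x) \<le> u x"
    proof cases
      case 1
      then show ?thesis using u_nonneg by simp
    next
      case 2
      have cz: "0 \<le> c z" using 2 SB cB by auto
      \<comment> \<open>Shell points have norm at most \<open>2 * j + 1\<close>; then
        \<open>a + b \<le> (a + 1) * (b + 1)\<close> separates the dependence on
        \<open>x - z\<close> from that on \<open>j\<close>.\<close>
      have "real (nrm K x) \<le> real (nrm K (x - z)) + (2 * j + 1)"
        using nrm_le_nrm_diff_add [of K x z] 2 by (auto simp: S_def lshell_def)
      also have "\<dots> \<le> (real (nrm K (x - z)) + 1) * (2 * j + 2)"
        by (simp add: algebra_simps)
      finally have "f x * real (nrm K x) \<le> f x * ((real (nrm K (x - z)) + 1) * (2 * j + 2))"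
        using f_nonneg by (intro mult_left_mono) auto
      also have "\<dots> = c z * (2 * j + 2) * w (x - z)"
        by (simp add: 2 w_def algebra_simps)
      also have "\<dots> \<le> u x"
        unfolding u_def using 2 cB SB w_nonneg
        by (intro member_le_sum [of z S "\<lambda>z. c z * (2 * j + 2) * w (x - z)"] mult_nonneg_nonneg) auto
      finally show ?thesis .
    qed
  qed
  have w_summable: "w summable_on root_lattice K"
    unfolding w_def by (rule summable_on_power_nrm_mult [OF s])
  have w_shift: "((\<lambda>x. w (x - z)) has_sum infsum w (root_lattice K)) (root_lattice K)" if "z \<in> S" for z
  proof -
    have "bij_betw (\<lambda>x. x - z) (root_lattice K) (root_lattice K)"
      using that SB BL by (intro bij_betw_lattice_diff) auto
    from has_sum_reindex_bij_betw [OF this, of w] show ?thesis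
      using w_summable by simp
  qed
  have "(u has_sum (\<Sum>z\<in>S. c z * (2 * j + 2) * infsum w (root_lattice K))) (root_lattice K)"
    unfolding u_def by (intro has_sum_finite_sum fin has_sum_cmult_right w_shift)
  then have u_sum: "infsum u (root_lattice K) = (\<Sum>z\<in>S. c z) * (2 * j + 2) * infsum w (root_lattice K)"
    and u_summable: "u summable_on root_lattice K"
    by (auto simp: infsumI sum_distrib_right summable_on_def)
  have "u summable_on Out"
    using u_summable by (rule summable_on_subset) (auto simp: Out_def)
  note u_Out = this
  have fn_Out: "(\<lambda>x. f x * real (nrm K x)) summable_on Out"
    using u_Out by (rule summable_on_comparison_test) (use f_nrm_le f_nonneg in auto)
  have f_Out: "f summable_on Out"
    using fn_Out by (rule summable_on_comparison_test) (use f_le f_nonneg in auto)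
  have L: "root_lattice K = B \<union> Out" "B \<inter> Out = {}"
    using BL by (auto simp: Out_def)
  have split: "infsum g (root_lattice K) = sum g B + infsum g Out" "g summable_on root_lattice K"
    if "g summable_on Out" for g :: "_ \<Rightarrow> real"
    unfolding L(1) using that L(2)
    by (auto simp: infsum_Un_disjoint summable_on_Un_disjoint)
  have "noise_cost K \<theta> * infsum f (root_lattice K) \<le> infsum (\<lambda>x. f x * real (nrm K x)) (root_lattice K)"
    using f_nonneg f_DP split(2) [OF f_Out] split(2) [OF fn_Out] by (intro noise_cost_le_profile)
  then have "noise_cost K \<theta> * sum f B + noise_cost K \<theta> * infsum f Out
      \<le> (\<Sum>x\<in>B. f x * real (nrm K x)) + infsum (\<lambda>x. f x * real (nrm K x)) Out"
    by (simp add: split f_Out fn_Out distrib_left)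
  moreover have "infsum (\<lambda>x. f x * real (nrm K x)) Out \<le> infsum u Out"
    using fn_Out u_Out f_nrm_le by (rule infsum_mono)
  moreover have "infsum u Out \<le> infsum u (root_lattice K)"
    using u_Out u_summable
  proof (rule infsum_mono2)
    show "0 \<le> u x" for x
      using cB SB w_nonneg unfolding u_def by (intro sum_nonneg mult_nonneg_nonneg) auto
  qed (auto simp: Out_def)
  moreover have "0 \<le> noise_cost K \<theta> * infsum f Out"
    using noise_cost_nonneg [OF \<theta>] f_nonneg by (intro mult_nonneg_nonneg infsum_nonneg)
  moreover have "(\<Sum>x\<in>B. c x * (real (nrm K x) - noise_cost K \<theta>)) =
      (\<Sum>x\<in>B. f x * real (nrm K x)) - noise_cost K \<theta> * sum f B"
    by (simp add: f_def sum_distrib_right right_diff_distrib sum_subtractf mult.commute [of "noise_cost K \<theta>"])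
  ultimately show ?thesis
    unfolding u_sum B_def S_def w_def [abs_def] s_def by linarith
qed

text \<open>Pigeonhole over the shells between \<open>j0\<close> and \<open>J\<close>, with
  \<open>J\<close> independent of \<open>c\<close>. If some shell is light, cutting there makes the
  extension of \<open>ball_profile_cost\<close> cheap. If all are heavy, their first moments alone
  already pay for \<open>noise_cost K \<theta>\<close> times the mass.\<close>

lemma local_noise_cost:
  assumes \<theta>: "0 < \<theta>" "\<theta> < 1" and \<epsilon>: "0 < \<epsilon>"
  obtains J :: nat where "noise_cost K \<theta> \<le> 2 * J"
    "\<And>c. \<lbrakk>\<And>x. x \<in> lball K (2 * J) \<Longrightarrow> 0 \<le> c x;
       \<And>x y. \<lbrakk>x \<in> lball K (2 * J); y \<in> lball K (2 * J)\<rbrakk> \<Longrightarrow> sqrt \<theta> ^ nrm K (x - y) * c y \<le> c x\<rbrakk>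
     \<Longrightarrow> 0 \<le> (\<Sum>x\<in>lball K (2 * J). c x * (real (nrm K x) - noise_cost K \<theta> + \<epsilon>))"
proof -
  define C where "C = noise_cost K \<theta>"
  have C: "0 \<le> C" using noise_cost_nonneg [OF \<theta>] by (simp add: C_def)
  \<comment> \<open>The added 1 makes division by \<open>A\<close> safe without a lower bound on the
    sum.\<close>
  define A where "A = infsum (\<lambda>x. sqrt \<theta> ^ nrm K x * (real (nrm K x) + 1)) (root_lattice K) + 1"
  have A: "0 < A"
    unfolding A_def using \<theta> by (intro add_nonneg_pos infsum_nonneg) auto
  \<comment> \<open>From shell \<open>j0\<close> on the norm is at least \<open>C\<close>. The
    number \<open>d\<close> of shells is such that, at \<open>\<epsilon> * M / (2 * A)\<close> each,
    their moments add up to at least \<open>C * M\<close>.\<close>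
  define j0 where "j0 = nat \<lceil>C\<rceil> + 1"
  define d where "d = nat \<lceil>2 * A * C / \<epsilon>\<rceil>"
  define J where "J = j0 + d"
  have j0: "C \<le> real j0" "1 \<le> j0"
    unfolding j0_def by linarith+
  have d: "C \<le> d * \<epsilon> / (2 * A)"
  proof -
    have "2 * A * C / \<epsilon> \<le> real d"
      unfolding d_def by linarith
    then show ?thesis
      using A \<epsilon> by (simp add: field_simps)
  qed
  show thesis
  proof (rule that)
    show "noise_cost K \<theta> \<le> 2 * J"
      using j0 unfolding J_def C_def by simp
  next
    fix c :: "(nat \<Rightarrow> int) \<Rightarrow> real"
    let ?B = "lball K (2 * J)"
    assume nonneg: "\<And>x. x \<in> ?B \<Longrightarrow> 0 \<le> c x"
      and lip: "\<And>x y. \<lbrakk>x \<in> ?B; y \<in> ?B\<rbrakk> \<Longrightarrow> sqrt \<theta> ^ nrm K (x - y) * c y \<le> c x"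
    define M where "M = sum c ?B"
    define m where "m j = sum c (lshell K j)" for j
    have M: "0 \<le> M" unfolding M_def using nonneg by (intro sum_nonneg)
    have sub: "lball K (2 * j + 2) \<subseteq> ?B" "lshell K j \<subseteq> ?B" if "j < J" for j
      using that by (auto simp: lball_def lshell_def)
    have eq: "(\<Sum>x\<in>?B. c x * (real (nrm K x) - noise_cost K \<theta> + \<epsilon>)) =
        (\<Sum>x\<in>?B. c x * (real (nrm K x) - C)) + \<epsilon> * M"
      by (simp add: C_def M_def sum_distrib_left algebra_simps sum.distrib sum_subtractf)
    show "0 \<le> (\<Sum>x\<in>?B. c x * (real (nrm K x) - noise_cost K \<theta> + \<epsilon>))"
    proof (cases "\<exists>j\<in>{j0..<J}. m j * (2 * j + 2) * A \<le> \<epsilon> * M")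
      case True
      then obtain j where j: "j0 \<le> j" "j < J" "m j * (2 * j + 2) * A \<le> \<epsilon> * M"
        by auto
      have m: "0 \<le> m j"
        unfolding m_def using nonneg sub(2) [OF j(2)] by (intro sum_nonneg) auto
      have "- (m j * (2 * j + 2) * (A - 1)) \<le> (\<Sum>x\<in>lball K (2 * j + 2). c x * (real (nrm K x) - C))"
        using ball_profile_cost [OF \<theta>, of K j c] nonneg lip sub(1) [OF j(2)]
        unfolding m_def C_def A_def by (simp add: subset_iff)
      \<comment> \<open>Beyond the light shell the norm is at least \<open>C\<close>, so enlarging
        the ball adds only nonnegative terms.\<close>
      also have "\<dots> \<le> (\<Sum>x\<in>?B. c x * (real (nrm K x) - C))"
      proof (rule sum_mono2)
        fix x assume x: "x \<in> ?B - lball K (2 * j + 2)"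
        then have "C \<le> real (nrm K x)"
          using j0 j(1) by (auto simp: lball_def)
        then show "0 \<le> c x * (real (nrm K x) - C)"
          using x nonneg by auto
      qed (use sub j in auto)
      finally have "- (m j * (2 * j + 2) * (A - 1)) \<le> (\<Sum>x\<in>?B. c x * (real (nrm K x) - C))" .
      moreover have "m j * (2 * j + 2) * (A - 1) \<le> m j * (2 * j + 2) * A"
        using m by (intro mult_left_mono) auto
      ultimately show ?thesis
        using j(3) unfolding eq by linarith
    next
      case False
      have "C * M \<le> d * \<epsilon> / (2 * A) * M"
        using d M by (rule mult_right_mono)
      also have "\<dots> = (\<Sum>j\<in>{j0..<J}. \<epsilon> * M / (2 * A))"
        by (simp add: J_def)
      also have "\<dots> \<le> (\<Sum>j\<in>{j0..<J}. \<Sum>x\<in>lshell K j. c x * real (nrm K x))"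
      proof (rule sum_mono)
        fix j assume j: "j \<in> {j0..<J}"
        then have "\<epsilon> * M \<le> m j * (2 * j + 2) * A"
          using False by (auto simp: not_le intro: less_imp_le)
        then have "\<epsilon> * M / (2 * A) \<le> m j * (real j + 1)"
          using A by (simp add: field_simps)
        also have "\<dots> = (\<Sum>x\<in>lshell K j. c x * (real j + 1))"
          by (simp add: m_def sum_distrib_right)
        \<comment> \<open>The norm on the shell is at least \<open>2 * j\<close>, which is at least
          \<open>j + 1\<close> because \<open>j0\<close> is at least 1.\<close>
        also have "\<dots> \<le> (\<Sum>x\<in>lshell K j. c x * real (nrm K x))"
          using j j0(2) nonneg sub(2) [of j]
          by (intro sum_mono mult_left_mono) (auto simp: lshell_def)
        finally show "\<epsilon> * M / (2 * A) \<le> (\<Sum>x\<in>lshell K j. c x * real (nrm K x))" .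
      qed
      also have "\<dots> = (\<Sum>x\<in>(\<Union>j\<in>{j0..<J}. lshell K j). c x * real (nrm K x))"
        by (rule sum.UNION_disjoint [symmetric]) (simp_all, auto simp: lshell_def)
      also have "\<dots> \<le> (\<Sum>x\<in>?B. c x * real (nrm K x))"
      proof (rule sum_mono2)
        show "(\<Union>j\<in>{j0..<J}. lshell K j) \<subseteq> ?B"
          using sub(2) by (intro UN_least) auto
      qed (use nonneg in auto)
      finally have "0 \<le> (\<Sum>x\<in>?B. c x * (real (nrm K x) - C))"
        by (simp add: M_def sum_distrib_left algebra_simps sum_subtractf)
      then show ?thesis
        using \<epsilon> M unfolding eq by simp
    qed
  qed
qed

section \<open>The multinomial distribution\<close>

definition mprob :: "nat \<Rightarrow> (nat \<Rightarrow> real) \<Rightarrow> nat \<Rightarrow> (nat \<Rightarrow> nat) \<Rightarrow> real" where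
  "mprob K p n h = multinom K n h * (\<Prod>k<K. p k ^ h k)"

lemma hist_le: "h \<in> hist K n \<Longrightarrow> h k \<le> n"
  using member_le_sum [of k "{..<K}" h] by (cases "k < K") (auto simp: hist_def)

lemma finite_hist [simp]: "finite (hist K n)"
proof (rule finite_subset)
  show "hist K n \<subseteq> {h. \<forall>k. (k \<in> {..<K} \<longrightarrow> h k \<in> {..n}) \<and> (k \<notin> {..<K} \<longrightarrow> h k = 0)}"
    using hist_le by (auto simp: hist_def)
qed (rule finite_set_of_finite_funs; simp)

lemma hist_0: "hist K 0 = {\<lambda>_. 0}"
  by (auto simp: hist_def fun_eq_iff) (metis lessThan_iff not_le)

lemma sum_fun_upd_Suc:
  fixes h :: "nat \<Rightarrow> nat"
  shows "i < K \<Longrightarrow> (\<Sum>k<K. (h(i := Suc (h i))) k) = Suc (\<Sum>k<K. h k)"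
  by (simp only: sum.remove [OF finite_lessThan [of K], of i] lessThan_iff) (auto intro!: sum.cong)

lemma hist_upd_Suc: "i < K \<Longrightarrow> h(i := Suc (h i)) \<in> hist K (Suc n) \<longleftrightarrow> h \<in> hist K n"
  using sum_fun_upd_Suc [of i K h] by (auto simp: hist_def)

lemma hist_Suc_cases:
  assumes "h \<in> hist K (Suc n)" "0 < h i"
  obtains g where "g \<in> hist K n" "h = g(i := Suc (g i))" "i < K"
proof -
  have i: "i < K" by (rule ccontr) (use assms in \<open>auto simp: hist_def\<close>)
  define g where "g = h(i := h i - 1)"
  have "h = g(i := Suc (g i))"
    using assms(2) by (auto simp: g_def)
  with assms(1) i hist_upd_Suc [of i K g n] that show thesis by metis
qed

lemma inj_upd_Suc: "inj (\<lambda>h :: nat \<Rightarrow> nat. h(i := Suc (h i)))"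
proof (rule injI)
  fix h g :: "nat \<Rightarrow> nat" assume eq: "h(i := Suc (h i)) = g(i := Suc (g i))"
  show "h = g"
  proof
    fix k show "h k = g k"
      using fun_cong [OF eq, of k] by (cases "k = i") auto
  qed
qed

lemma hist_Suc_image:
  "i < K \<Longrightarrow> (\<lambda>h. h(i := Suc (h i))) ` hist K n = {h \<in> hist K (Suc n). 0 < h i}"
  by (auto simp: hist_upd_Suc elim!: hist_Suc_cases)

lemma mprob_nonneg: "is_prob_vec K p \<Longrightarrow> 0 \<le> mprob K p n h"
  unfolding mprob_def multinom_def is_prob_vec_def
  by (intro mult_nonneg_nonneg divide_nonneg_nonneg prod_nonneg) (auto intro: less_imp_le)

text \<open>The ratio of adjacent multinomial weights; the moment and shift estimates below all
  derive from it.\<close>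

lemma mprob_Suc:
  assumes i: "i < K"
  shows "(real (h i) + 1) * mprob K p (Suc n) (h(i := Suc (h i))) = (real n + 1) * p i * mprob K p n h"
proof -
  have fin: "finite {..<K}" "i \<in> {..<K}" using i by auto
  have a: "(\<Prod>k<K. fact ((h(i := Suc (h i))) k)) = (real (h i) + 1) * (\<Prod>k<K. fact (h k))"
    unfolding prod.remove [OF fin] by (simp add: algebra_simps)
  have b: "(\<Prod>k<K. p k ^ (h(i := Suc (h i))) k) = p i * (\<Prod>k<K. p k ^ h k)"
    unfolding prod.remove [OF fin] by simp
  define F where "F = real (h i) + 1"
  have "F \<noteq> 0" unfolding F_def by linarith
  then show ?thesis
    unfolding mprob_def multinom_def a b F_def [symmetric] by (simp add: mult_ac add_ac)
qed

text \<open>Size-biasing: weighting by the entry \<open>h i\<close> amounts to drawing one item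
  fewer and then adding one of kind \<open>i\<close>. With \<phi> constant it yields the mean, with
  \<phi> the entry itself the second moment.\<close>

lemma sum_mprob_Suc:
  assumes i: "i < K"
  shows "(\<Sum>h\<in>hist K (Suc n). mprob K p (Suc n) h * real (h i) * \<phi> h) =
    (real n + 1) * p i * (\<Sum>h\<in>hist K n. mprob K p n h * \<phi> (h(i := Suc (h i))))"
proof -
  have "(\<Sum>h\<in>hist K (Suc n). mprob K p (Suc n) h * real (h i) * \<phi> h) =
      (\<Sum>h\<in>(\<lambda>h. h(i := Suc (h i))) ` hist K n. mprob K p (Suc n) h * real (h i) * \<phi> h)"
    unfolding hist_Suc_image [OF i] by (intro sum.mono_neutral_right) auto
  also have "\<dots> = (\<Sum>h\<in>hist K n. ((real (h i) + 1) * mprob K p (Suc n) (h(i := Suc (h i)))) *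
      \<phi> (h(i := Suc (h i))))"
    by (subst sum.reindex) (auto intro: inj_on_subset [OF inj_upd_Suc] intro!: sum.cong)
  also have "\<dots> = (real n + 1) * p i * (\<Sum>h\<in>hist K n. mprob K p n h * \<phi> (h(i := Suc (h i))))"
    unfolding mprob_Suc [OF i] sum_distrib_left by (simp add: algebra_simps)
  finally show ?thesis .
qed

text \<open>Weighting the induction hypothesis by \<open>\<Sum>i. h i = n + 1\<close> replaces the multinomial theorem.\<close>

lemma sum_mprob:
  assumes p: "is_prob_vec K p"
  shows "(\<Sum>h\<in>hist K n. mprob K p n h) = 1"
proof (induction n)
  case 0
  then show ?case
    by (simp add: hist_0 mprob_def multinom_def)
next
  case (Suc n)
  have "(real n + 1) * (\<Sum>h\<in>hist K (Suc n). mprob K p (Suc n) h) =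
      (\<Sum>h\<in>hist K (Suc n). mprob K p (Suc n) h * (\<Sum>i<K. real (h i)))"
  proof -
    have "(\<Sum>i<K. real (h i)) = real n + 1" if "h \<in> hist K (Suc n)" for h
      using that by (simp add: hist_def flip: of_nat_sum)
    then show ?thesis
      unfolding sum_distrib_left [of "real n + 1"] by (intro sum.cong) (auto simp: mult.commute)
  qed
  also have "\<dots> = (\<Sum>i<K. \<Sum>h\<in>hist K (Suc n). mprob K p (Suc n) h * real (h i) * 1)"
    unfolding sum_distrib_left by (subst sum.swap) simp
  also have "\<dots> = (\<Sum>i<K. (real n + 1) * p i)"
    using sum_mprob_Suc [of _ K p n "\<lambda>_. 1"] Suc by (intro sum.cong) auto
  also have "\<dots> = real n + 1"
    using p by (simp add: is_prob_vec_def flip: sum_distrib_left)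
  finally show ?case by simp
qed

text \<open>Size-biasing gives the first two moments and hence the binomial variance, whose negative
  part \<open>Suc n * (p i)^2\<close> is discarded.\<close>

lemma mprob_variance:
  fixes p :: "nat \<Rightarrow> real"
  assumes p: "is_prob_vec K p" and i: "i < K"
  shows "(\<Sum>h\<in>hist K (Suc n). mprob K p (Suc n) h * (real (h i) - Suc n * p i)\<^sup>2) \<le> Suc n * p i"
proof -
  \<comment> \<open>Stated for every size, since the second moment at \<open>Suc n\<close> calls for
    the mean at \<open>n\<close>.\<close>
  have m1: "(\<Sum>h\<in>hist K (Suc n). mprob K p (Suc n) h * real (h i)) = Suc n * p i" for n
    using sum_mprob_Suc [OF i, of p n "\<lambda>_. 1"] sum_mprob [OF p] by (simp add: algebra_simps)
  have m0: "(\<Sum>h\<in>hist K n. mprob K p n h * real (h i)) = n * p i"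
    using m1 by (cases n) (auto simp: hist_0)
  have m2: "(\<Sum>h\<in>hist K (Suc n). mprob K p (Suc n) h * real (h i) * real (h i)) =
      Suc n * p i * (n * p i + 1)"
    using sum_mprob_Suc [OF i, of p n "\<lambda>h. real (h i)"] sum_mprob [OF p, of n] m0
    by (simp add: algebra_simps sum.distrib)
  have "(\<Sum>h\<in>hist K (Suc n). mprob K p (Suc n) h * (real (h i) - Suc n * p i)\<^sup>2) =
      (\<Sum>h\<in>hist K (Suc n). mprob K p (Suc n) h * real (h i) * real (h i)
        - 2 * (Suc n * p i) * (mprob K p (Suc n) h * real (h i))
        + (Suc n * p i)\<^sup>2 * mprob K p (Suc n) h)"
    by (intro sum.cong) (auto simp: power2_eq_square algebra_simps)
  also have "\<dots> = Suc n * p i * (n * p i + 1) - 2 * (Suc n * p i) * (Suc n * p i)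
      + (Suc n * p i)\<^sup>2 * 1"
    unfolding sum.distrib sum_subtractf sum_distrib_left [symmetric] m1 m2 sum_mprob [OF p] ..
  also have "\<dots> = Suc n * p i - Suc n * (p i)\<^sup>2"
    by (simp add: power2_eq_square algebra_simps)
  finally show ?thesis by simp
qed

text \<open>The variance bound becomes a bound in mean by a pointwise arithmetic-geometric
  inequality in place of Cauchy-Schwarz.\<close>

lemma mprob_deviation:
  fixes p :: "nat \<Rightarrow> real"
  assumes p: "is_prob_vec K p" and i: "i < K" and n: "0 < n"
  shows "(\<Sum>h\<in>hist K n. mprob K p n h * \<bar>real (h i) / (n * p i) - 1\<bar>) \<le> 1 / sqrt (n * p i)"
proof -
  define m where "m = n * p i"
  have "0 < p i" using p i by (auto simp: is_prob_vec_def)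
  then have m: "0 < m" using n by (simp add: m_def)
  have var: "(\<Sum>h\<in>hist K n. mprob K p n h * (real (h i) - m)\<^sup>2) \<le> m"
    using mprob_variance [OF p i, of "n - 1"] n by (simp add: m_def)
  \<comment> \<open>Balanced at the standard deviation scale \<open>sqrt m\<close>, so that both
    terms contribute \<open>1 / (2 * sqrt m)\<close> after averaging.\<close>
  have dev: "\<bar>x / m - 1\<bar> \<le> (1 / (2 * m * sqrt m)) * (x - m)\<^sup>2 + 1 / (2 * sqrt m)" for x
  proof -
    have "0 \<le> (\<bar>x - m\<bar> - sqrt m)\<^sup>2" by simp
    then have "2 * sqrt m * \<bar>x - m\<bar> \<le> (x - m)\<^sup>2 + m"
      using m by (simp add: power2_diff mult_ac)
    then have "2 * sqrt m * \<bar>x - m\<bar> / (2 * m * sqrt m) \<le> ((x - m)\<^sup>2 + m) / (2 * m * sqrt m)"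
      using m by (intro divide_right_mono) auto
    moreover have "2 * sqrt m * \<bar>x - m\<bar> / (2 * m * sqrt m) = \<bar>x / m - 1\<bar>"
    proof -
      have "x / m - 1 = (x - m) / m" using m by (simp add: field_simps)
      then show ?thesis using m by (simp add: abs_divide)
    qed
    moreover have "((x - m)\<^sup>2 + m) / (2 * m * sqrt m) = (1 / (2 * m * sqrt m)) * (x - m)\<^sup>2 + 1 / (2 * sqrt m)"
      using m by (simp add: add_divide_distrib)
    ultimately show ?thesis by simp
  qed
  have "(\<Sum>h\<in>hist K n. mprob K p n h * \<bar>real (h i) / m - 1\<bar>) \<le>
      (\<Sum>h\<in>hist K n. mprob K p n h * ((1 / (2 * m * sqrt m)) * (real (h i) - m)\<^sup>2 + 1 / (2 * sqrt m)))"
    using dev mprob_nonneg [OF p] by (intro sum_mono mult_left_mono) auto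
  also have "\<dots> = (1 / (2 * m * sqrt m)) * (\<Sum>h\<in>hist K n. mprob K p n h * (real (h i) - m)\<^sup>2)
      + 1 / (2 * sqrt m) * (\<Sum>h\<in>hist K n. mprob K p n h)"
    unfolding sum_distrib_left by (simp add: algebra_simps sum.distrib)
  also have "\<dots> \<le> (1 / (2 * m * sqrt m)) * m + 1 / (2 * sqrt m) * 1"
    unfolding sum_mprob [OF p] using var m by (intro add_right_mono mult_left_mono) auto
  also have "\<dots> = 1 / sqrt m"
    using m by (simp add: field_simps)
  finally show ?thesis by (simp add: m_def)
qed

section \<open>Asymptotics of the multinomial weights\<close>

lemma tendsto_inverse_sqrt_mult:
  fixes a :: real
  assumes "0 < a"
  shows "(\<lambda>n. 1 / sqrt (real n * a)) \<longlonglongrightarrow> 0"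
  using assms by real_asymp

text \<open>Eventually \<open>T n\<close> is below half of each mean \<open>n * p k\<close>, so a
  small entry deviates from its mean by at least half of it. Markov's inequality and a union bound
  over \<open>k\<close> finish the proof.\<close>

lemma mprob_small_coordinate:
  fixes T :: "nat \<Rightarrow> nat"
  assumes p: "is_prob_vec K p" and T: "(\<lambda>n. T n / n) \<longlonglongrightarrow> 0"
  shows "(\<lambda>n. \<Sum>h\<in>{h \<in> hist K n. \<exists>k<K. h k < T n}. mprob K p n h) \<longlonglongrightarrow> 0"
proof -
  have pos: "0 < p k" if "k < K" for k
    using p that by (auto simp: is_prob_vec_def)
  have "eventually (\<lambda>n. T n / n < p k / 2) sequentially" if "k < K" for k
    using order_tendstoD(2) [OF T, of "p k / 2"] pos [OF that] by auto
  then have "eventually (\<lambda>n. \<forall>k\<in>{..<K}. T n / n < p k / 2) sequentially"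
    by (intro eventually_ball_finite) auto
  then have ev: "eventually (\<lambda>n. (\<Sum>h\<in>{h \<in> hist K n. \<exists>k<K. h k < T n}. mprob K p n h) \<le>
      (\<Sum>k<K. 2 * (1 / sqrt (n * p k)))) sequentially"
    using eventually_gt_at_top [of 0]
  proof eventually_elim
    case (elim n)
    have small: "1 \<le> 2 * \<bar>real (h k) / (n * p k) - 1\<bar>" if "k < K" "h k < T n" for h k
    proof -
      have "real (h k) < n * p k / 2"
      proof -
        have "real (h k) < real (T n)" using that by simp
        also have "\<dots> < n * (p k / 2)"
          using elim that(1) by (simp add: field_simps)
        finally show ?thesis by simp
      qed
      then have "real (h k) / (n * p k) < 1 / 2"
        using elim pos [OF that(1)] by (simp add: field_simps)
      moreover have "1 \<le> 2 * \<bar>a - 1\<bar>" if "a < 1 / 2" for a :: real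
        using that by (simp add: abs_if)
      ultimately show ?thesis by blast
    qed
    have "(\<Sum>h\<in>{h \<in> hist K n. \<exists>k<K. h k < T n}. mprob K p n h) \<le>
        (\<Sum>h\<in>hist K n. \<Sum>k<K. 2 * (mprob K p n h * \<bar>real (h k) / (n * p k) - 1\<bar>))"
    proof (rule sum_le_included [where i = "\<lambda>h. h"])
      show "\<forall>h\<in>{h \<in> hist K n. \<exists>k<K. h k < T n}. \<exists>y\<in>hist K n. y = h \<and>
          mprob K p n h \<le> (\<Sum>k<K. 2 * (mprob K p n y * \<bar>real (y k) / (n * p k) - 1\<bar>))"
      proof clarsimp
        fix h k assume k: "k < K" "h k < T n"
        have "mprob K p n h \<le> 2 * (mprob K p n h * \<bar>real (h k) / (n * p k) - 1\<bar>)"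
          using mult_left_mono [OF small [where h = h, OF k] mprob_nonneg [OF p, of n h]] by (simp add: mult_ac)
        also have "\<dots> \<le> (\<Sum>k<K. 2 * (mprob K p n h * \<bar>real (h k) / (n * p k) - 1\<bar>))"
          using k mprob_nonneg [OF p]
          by (intro member_le_sum [of k "{..<K}" "\<lambda>k. 2 * (mprob K p n h * \<bar>real (h k) / (n * p k) - 1\<bar>)"]) auto
        finally show "mprob K p n h \<le> (\<Sum>k<K. 2 * (mprob K p n h * \<bar>real (h k) / (n * p k) - 1\<bar>))" .
      qed
    qed (auto intro!: sum_nonneg mult_nonneg_nonneg mprob_nonneg [OF p])
    also have "\<dots> = (\<Sum>k<K. 2 * (\<Sum>h\<in>hist K n. mprob K p n h * \<bar>real (h k) / (n * p k) - 1\<bar>))"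
      by (subst sum.swap) (simp add: sum_distrib_left)
    also have "\<dots> \<le> (\<Sum>k<K. 2 * (1 / sqrt (n * p k)))"
      using mprob_deviation [OF p _ elim(2)] by (intro sum_mono mult_left_mono) auto
    finally show ?case .
  qed
  have "(\<lambda>n. \<Sum>k<K. 2 * (1 / sqrt (n * p k))) \<longlonglongrightarrow> (\<Sum>k<K. 2 * 0)"
    using pos by (intro tendsto_sum tendsto_mult tendsto_const tendsto_inverse_sqrt_mult) auto
  then have lim: "(\<lambda>n. \<Sum>k<K. 2 * (1 / sqrt (n * p k))) \<longlonglongrightarrow> 0" by simp
  show ?thesis
    by (rule tendsto_sandwich [OF _ ev tendsto_const lim])
      (auto intro!: always_eventually sum_nonneg mprob_nonneg [OF p])
qed

text \<open>By \<open>mprob_Suc\<close> the two weights differ by the factor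
  \<open>(h i + 1) / (Suc n * p i)\<close>, so the total difference is at most the mean relative
  deviation of an entry at size \<open>Suc n\<close>.\<close>

lemma mprob_shift_upd:
  fixes p :: "nat \<Rightarrow> real"
  assumes p: "is_prob_vec K p" and i: "i < K"
  shows "(\<Sum>h\<in>hist K n. \<bar>mprob K p n h - mprob K p (Suc n) (h(i := Suc (h i)))\<bar>)
    \<le> 1 / sqrt (Suc n * p i)"
proof -
  have pos: "0 < p i" using p i by (auto simp: is_prob_vec_def)
  let ?q = "mprob K p (Suc n)"
  have "(\<Sum>h\<in>hist K n. \<bar>mprob K p n h - ?q (h(i := Suc (h i)))\<bar>) =
      (\<Sum>h\<in>hist K n. ?q (h(i := Suc (h i))) * \<bar>(h(i := Suc (h i))) i / (Suc n * p i) - 1\<bar>)"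
  proof (rule sum.cong)
    fix h
    have "mprob K p n h = ?q (h(i := Suc (h i))) * ((h(i := Suc (h i))) i / (Suc n * p i))"
    proof -
      have "0 < Suc n * p i" using pos by simp
      moreover have "mprob K p n h * (Suc n * p i) = ?q (h(i := Suc (h i))) * (h(i := Suc (h i))) i"
        using mprob_Suc [OF i, of h p n] by (simp add: mult_ac add_ac)
      ultimately show ?thesis
        using pos by (simp add: eq_divide_eq)
    qed
    then have "mprob K p n h - ?q (h(i := Suc (h i))) =
        ?q (h(i := Suc (h i))) * ((h(i := Suc (h i))) i / (Suc n * p i) - 1)"
      by (simp add: right_diff_distrib)
    then show "\<bar>mprob K p n h - ?q (h(i := Suc (h i)))\<bar> =
        ?q (h(i := Suc (h i))) * \<bar>(h(i := Suc (h i))) i / (Suc n * p i) - 1\<bar>"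
      using mprob_nonneg [OF p, of "Suc n" "h(i := Suc (h i))"] by (simp only: abs_mult abs_of_nonneg)
  qed auto
  also have "\<dots> = (\<Sum>h\<in>(\<lambda>h. h(i := Suc (h i))) ` hist K n. ?q h * \<bar>h i / (Suc n * p i) - 1\<bar>)"
    by (subst sum.reindex) (auto intro: inj_on_subset [OF inj_upd_Suc])
  also have "\<dots> \<le> (\<Sum>h\<in>hist K (Suc n). ?q h * \<bar>h i / (Suc n * p i) - 1\<bar>)"
    unfolding hist_Suc_image [OF i] using mprob_nonneg [OF p] by (intro sum_mono2) auto
  also have "\<dots> \<le> 1 / sqrt (Suc n * p i)"
    using p i by (intro mprob_deviation) auto
  finally show ?thesis .
qed

text \<open>The items of \<open>a\<close> are added one at a time; each of the fixed number
  \<open>m\<close> of steps costs a vanishing amount by \<open>mprob_shift_upd\<close>.\<close>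

lemma mprob_shift:
  fixes p :: "nat \<Rightarrow> real"
  assumes p: "is_prob_vec K p"
  shows "a \<in> hist K m \<Longrightarrow>
    (\<lambda>n. \<Sum>h\<in>hist K n. \<bar>mprob K p n h - mprob K p (n + m) (\<lambda>k. h k + a k)\<bar>) \<longlonglongrightarrow> 0"
proof (induction m arbitrary: a)
  case 0
  then show ?case by (simp add: hist_0)
next
  case (Suc m)
  have "\<exists>i. 0 < a i"
  proof (rule ccontr)
    assume "\<nexists>i. 0 < a i"
    then have "(\<Sum>k<K. a k) = 0" by simp
    then show False using Suc.prems by (simp add: hist_def)
  qed
  then obtain i where "0 < a i" by blast
  with Suc.prems obtain b where b: "b \<in> hist K m" "a = b(i := Suc (b i))" and i: "i < K"
    by (elim hist_Suc_cases)
  have shift: "(\<lambda>k. h k + a k) = (\<lambda>k. (h(i := Suc (h i))) k + b k)" for h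
    by (auto simp: b(2))
  let ?S = "\<lambda>n. \<Sum>h\<in>hist K n. \<bar>mprob K p n h - mprob K p (n + m) (\<lambda>k. h k + b k)\<bar>"
  have "(\<Sum>h\<in>hist K n. \<bar>mprob K p n h - mprob K p (n + Suc m) (\<lambda>k. h k + a k)\<bar>)
      \<le> 1 / sqrt (Suc n * p i) + ?S (Suc n)" for n
  proof -
    let ?u = "\<lambda>h :: nat \<Rightarrow> nat. h(i := Suc (h i))"
    have "(\<Sum>h\<in>hist K n. \<bar>mprob K p n h - mprob K p (n + Suc m) (\<lambda>k. h k + a k)\<bar>) \<le>
      (\<Sum>h\<in>hist K n. \<bar>mprob K p n h - mprob K p (Suc n) (?u h)\<bar> +
        \<bar>mprob K p (Suc n) (?u h) - mprob K p (Suc n + m) (\<lambda>k. ?u h k + b k)\<bar>)"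
      unfolding shift by (intro sum_mono) auto
    also have "\<dots> = (\<Sum>h\<in>hist K n. \<bar>mprob K p n h - mprob K p (Suc n) (?u h)\<bar>) +
        (\<Sum>h\<in>?u ` hist K n. \<bar>mprob K p (Suc n) h - mprob K p (Suc n + m) (\<lambda>k. h k + b k)\<bar>)"
      unfolding sum.distrib by (subst sum.reindex) (auto intro: inj_on_subset [OF inj_upd_Suc])
    also have "\<dots> \<le> 1 / sqrt (Suc n * p i) + ?S (Suc n)"
      using mprob_shift_upd [OF p i, of n] unfolding hist_Suc_image [OF i]
      by (intro add_mono sum_mono2) auto
    finally show ?thesis .
  qed
  then have le: "eventually (\<lambda>n. (\<Sum>h\<in>hist K n. \<bar>mprob K p n h - mprob K p (n + Suc m) (\<lambda>k. h k + a k)\<bar>)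
      \<le> 1 / sqrt (Suc n * p i) + ?S (Suc n)) sequentially"
    by simp
  have "0 < p i" using p i by (auto simp: is_prob_vec_def)
  then have "(\<lambda>n. 1 / sqrt (Suc n * p i) + ?S (Suc n)) \<longlonglongrightarrow> 0 + 0"
    using Suc.IH [OF b(1)]
    by (intro tendsto_add LIMSEQ_Suc [OF tendsto_inverse_sqrt_mult]
        LIMSEQ_Suc [where f = ?S])
  then have lim: "(\<lambda>n. 1 / sqrt (Suc n * p i) + ?S (Suc n)) \<longlonglongrightarrow> 0" by simp
  show ?case
    by (rule tendsto_sandwich [OF _ le tendsto_const lim]) (auto intro!: sum_nonneg always_eventually)
qed

section \<open>The lower bound\<close>

abbreviation emb :: "(nat \<Rightarrow> nat) \<Rightarrow> nat \<Rightarrow> int" where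
  "emb h \<equiv> (\<lambda>k. int (h k))"

text \<open>The input from which displacement \<open>x\<close> leads to output \<open>g\<close>. It
  is a genuine difference only when no entry of \<open>x\<close> exceeds that of \<open>g\<close>,
  since \<open>nat\<close> truncates.\<close>

definition hsub :: "(nat \<Rightarrow> nat) \<Rightarrow> (nat \<Rightarrow> int) \<Rightarrow> nat \<Rightarrow> nat" where
  "hsub g x = (\<lambda>k. nat (int (g k) - x k))"

lemma l1_eq_nrm: "l1 K h g = real (nrm K (emb h - emb g))"
  unfolding l1_def nrm_def of_nat_sum by (intro sum.cong) auto

lemma hist_diff_lattice:
  assumes "h \<in> hist K n" "g \<in> hist K n"
  shows "emb h - emb g \<in> root_lattice K"
  using assms by (auto simp: hist_def root_lattice_def sum_subtractf simp flip: of_nat_sum)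

lemma emb_hsub:
  assumes "g \<in> hist K n" "x \<in> root_lattice K" "\<And>k. k < K \<Longrightarrow> x k \<le> int (g k)"
  shows "emb (hsub g x) = emb g - x"
proof
  fix k show "emb (hsub g x) k = (emb g - x) k"
    using assms by (cases "k < K") (auto simp: hsub_def hist_def root_lattice_def)
qed

lemma hsub_in_hist:
  assumes "g \<in> hist K n" "x \<in> root_lattice K" "\<And>k. k < K \<Longrightarrow> x k \<le> int (g k)"
  shows "hsub g x \<in> hist K n"
proof -
  have "int (\<Sum>k<K. hsub g x k) = (\<Sum>k<K. int (g k) - x k)"
    using fun_cong [OF emb_hsub [OF assms]] by simp
  also have "\<dots> = int (\<Sum>k<K. g k)"
    using assms(2) by (simp add: sum_subtractf root_lattice_def)
  finally show ?thesis
    using assms(1,2) by (auto simp: hist_def hsub_def root_lattice_def simp del: of_nat_sum)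
qed

lemma hist_ex_greater:
  assumes "h \<in> hist K n" "g \<in> hist K n" "h \<noteq> g"
  obtains i where "i < K" "g i < h i"
proof (rule ccontr)
  assume "\<not> thesis"
  then have le: "\<forall>k\<in>{..<K}. h k \<le> g k"
    using that by (auto simp: not_less [symmetric])
  obtain k where "h k \<noteq> g k" using assms(3) by auto
  moreover from this have "k < K"
    using assms(1,2) by (metis (mono_tags, lifting) hist_def mem_Collect_eq not_le)
  ultimately have "\<exists>k\<in>{..<K}. h k < g k"
    using le by (auto simp: order_less_le)
  with le have "(\<Sum>k<K. h k) < (\<Sum>k<K. g k)"
    by (intro sum_strict_mono_ex1) auto
  then show False using assms by (simp add: hist_def)
qed

lemma sum_remove2:
  fixes f :: "nat \<Rightarrow> 'a :: comm_monoid_add"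
  assumes "i < K" "j < K" "i \<noteq> j"
  shows "(\<Sum>k<K. f k) = f i + (f j + (\<Sum>k\<in>{..<K} - {i} - {j}. f k))"
  using assms sum.remove [of "{..<K}" i f] sum.remove [of "{..<K} - {i}" j f] by simp

text \<open>One unit is moved from an entry where \<open>h\<close> exceeds \<open>g\<close> to an
  entry where it falls short; both exist because the totals agree.\<close>

lemma hist_step:
  assumes h: "h \<in> hist K n" and g: "g \<in> hist K n" and "h \<noteq> g"
  obtains h' where "h' \<in> hist K n" "neighboring K h' h"
    "nrm K (emb h - emb g) = nrm K (emb h' - emb g) + 2"
proof -
  obtain i where i: "i < K" "g i < h i" using assms by (rule hist_ex_greater)
  obtain j where j: "j < K" "h j < g j" using g h \<open>h \<noteq> g\<close> [symmetric] by (rule hist_ex_greater)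
  have ij: "i \<noteq> j" using i j by auto
  define h' where "h' = h(i := h i - 1, j := h j + 1)"
  have rest: "(\<Sum>k\<in>{..<K} - {i} - {j}. F (h' k) k) = (\<Sum>k\<in>{..<K} - {i} - {j}. F (h k) k)"
    for F :: "nat \<Rightarrow> nat \<Rightarrow> nat"
    by (intro sum.cong) (auto simp: h'_def)
  have "(\<Sum>k<K. h' k) = (\<Sum>k<K. h k)"
    using rest [of "\<lambda>v k. v"] i j ij unfolding sum_remove2 [OF i(1) j(1) ij] by (simp add: h'_def)
  then have "h' \<in> hist K n"
    using h i j by (auto simp: hist_def h'_def)
  moreover have "nrm K (emb h' - emb h) = 2"
    using rest [of "\<lambda>v k. nat \<bar>int v - int (h k)\<bar>"] i j ij
    unfolding nrm_def sum_remove2 [OF i(1) j(1) ij] by (simp add: h'_def)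
  then have "neighboring K h' h"
    by (simp add: neighboring_def l1_eq_nrm)
  moreover have "nrm K (emb h - emb g) = nrm K (emb h' - emb g) + 2"
    using rest [of "\<lambda>v k. nat \<bar>int v - int (g k)\<bar>"] i j ij
    unfolding nrm_def sum_remove2 [OF i(1) j(1) ij] by (simp add: h'_def)
  ultimately show thesis by (rule that)
qed

text \<open>Chains the privacy constraint along a path of neighbours from \<open>h\<close> to
  \<open>g\<close>: each step costs \<theta> and shortens the distance by 2, hence
  \<open>sqrt \<theta>\<close> per unit of norm.\<close>

lemma DP_global:
  assumes DP: "is_DP K n \<theta> W" and \<theta>: "0 < \<theta>" and g: "g \<in> hist K n"
  shows "h \<in> hist K n \<Longrightarrow> sqrt \<theta> ^ nrm K (emb h - emb g) * pmf (W g) b \<le> pmf (W h) b"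
proof (induction "nrm K (emb h - emb g)" arbitrary: h rule: less_induct)
  case less
  show ?case
  proof (cases "h = g")
    case True
    then show ?thesis by (simp add: nrm_def)
  next
    case False
    obtain h' where h': "h' \<in> hist K n" "neighboring K h' h"
      and eq: "nrm K (emb h - emb g) = nrm K (emb h' - emb g) + 2"
      using hist_step [OF less.prems g False] by blast
    have "sqrt \<theta> ^ nrm K (emb h - emb g) * pmf (W g) b =
        \<theta> * (sqrt \<theta> ^ nrm K (emb h' - emb g) * pmf (W g) b)"
      using \<theta> by (simp add: eq power_add power2_eq_square)
    also have "\<dots> \<le> \<theta> * pmf (W h') b"
      using less.hyps [of h'] eq h' \<theta> by (intro mult_left_mono) auto
    also have "\<dots> \<le> pmf (W h) b"
      using DP h' less.prems by (auto simp: is_DP_def)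
    finally show ?thesis .
  qed
qed

text \<open>With \<open>x = a - b\<close> split into positive and negative parts of equal size
  \<open>m\<close>, both \<open>g\<close> and \<open>g - x\<close> arise from the smaller histogram
  \<open>g - a\<close> by adding \<open>a\<close> or \<open>b\<close>. Two uses of
  \<open>mprob_shift\<close> at size \<open>n - m\<close> compare their weights.\<close>

lemma mprob_lattice_shift:
  fixes p :: "nat \<Rightarrow> real"
  assumes p: "is_prob_vec K p" and x: "x \<in> root_lattice K"
  shows "(\<lambda>n. \<Sum>g\<in>{g \<in> hist K n. \<forall>k<K. x k \<le> int (g k)}. \<bar>mprob K p n (hsub g x) - mprob K p n g\<bar>)
    \<longlonglongrightarrow> 0"
proof -
  define a where "a = (\<lambda>k. nat (x k))"
  define b where "b = (\<lambda>k. nat (- x k))"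
  define m where "m = (\<Sum>k<K. a k)"
  have "int (\<Sum>k<K. a k) - int (\<Sum>k<K. b k) = (\<Sum>k<K. x k)"
    unfolding of_nat_sum sum_subtractf [symmetric] by (intro sum.cong) (auto simp: a_def b_def)
  then have "(\<Sum>k<K. b k) = m"
    using x by (simp add: m_def root_lattice_def del: of_nat_sum)
  then have ab: "a \<in> hist K m" "b \<in> hist K m"
    using x by (auto simp: hist_def root_lattice_def a_def b_def m_def)
  define S where "S c n = (\<Sum>h\<in>hist K n. \<bar>mprob K p n h - mprob K p (n + m) (\<lambda>k. h k + c k)\<bar>)" for c n
  have le: "(\<Sum>g\<in>{g \<in> hist K n. \<forall>k<K. x k \<le> int (g k)}. \<bar>mprob K p n (hsub g x) - mprob K p n g\<bar>)
      \<le> S a (n - m) + S b (n - m)" if n: "m \<le> n" for n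
  proof -
    let ?G = "{g \<in> hist K n. \<forall>k<K. x k \<le> int (g k)}"
    let ?f = "\<lambda>g k. g k - a k :: nat"
    have a_le: "a k \<le> g k" if "g \<in> ?G" for g k
      using that x by (cases "k < K") (auto simp: a_def root_lattice_def)
    have inj: "inj_on ?f ?G"
    proof (rule inj_onI)
      fix g g' assume g: "g \<in> ?G" "g' \<in> ?G" "?f g = ?f g'"
      show "g = g'"
      proof
        fix k show "g k = g' k"
          using fun_cong [OF g(3), of k] a_le [OF g(1), of k] a_le [OF g(2), of k] by simp
      qed
    qed
    have img: "?f ` ?G \<subseteq> hist K (n - m)"
    proof clarify
      fix g assume g: "g \<in> hist K n" "\<forall>k<K. x k \<le> int (g k)"
      then have "(\<Sum>k<K. g k - a k) = (\<Sum>k<K. g k) - (\<Sum>k<K. a k)"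
        using a_le [of g] by (intro sum_subtractf_nat) auto
      then show "?f g \<in> hist K (n - m)"
        using g by (auto simp: hist_def m_def)
    qed
    have "(\<Sum>g\<in>?G. \<bar>mprob K p n (hsub g x) - mprob K p n g\<bar>) \<le>
        (\<Sum>g\<in>?G. \<bar>mprob K p (n - m) (?f g) - mprob K p (n - m + m) (\<lambda>k. ?f g k + a k)\<bar> +
          \<bar>mprob K p (n - m) (?f g) - mprob K p (n - m + m) (\<lambda>k. ?f g k + b k)\<bar>)"
    proof (rule sum_mono)
      fix g assume g: "g \<in> ?G"
      have "(\<lambda>k. ?f g k + a k) = g" "(\<lambda>k. ?f g k + b k) = hsub g x"
        using a_le [OF g] by (auto simp: hsub_def a_def b_def fun_eq_iff nat_diff_distrib)
      then show "\<bar>mprob K p n (hsub g x) - mprob K p n g\<bar> \<le>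
          \<bar>mprob K p (n - m) (?f g) - mprob K p (n - m + m) (\<lambda>k. ?f g k + a k)\<bar> +
          \<bar>mprob K p (n - m) (?f g) - mprob K p (n - m + m) (\<lambda>k. ?f g k + b k)\<bar>"
        using n by simp
    qed
    also have "\<dots> = (\<Sum>h\<in>?f ` ?G. \<bar>mprob K p (n - m) h - mprob K p (n - m + m) (\<lambda>k. h k + a k)\<bar> +
          \<bar>mprob K p (n - m) h - mprob K p (n - m + m) (\<lambda>k. h k + b k)\<bar>)"
      by (simp only: sum.reindex [OF inj] o_def)
    also have "\<dots> \<le> (\<Sum>h\<in>hist K (n - m). \<bar>mprob K p (n - m) h - mprob K p (n - m + m) (\<lambda>k. h k + a k)\<bar> +
          \<bar>mprob K p (n - m) h - mprob K p (n - m + m) (\<lambda>k. h k + b k)\<bar>)"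
      using img by (intro sum_mono2) auto
    finally show ?thesis
      by (simp add: S_def sum.distrib)
  qed
  have "S c \<longlonglongrightarrow> 0" if "c \<in> hist K m" for c
    using mprob_shift [OF p that] by (simp add: S_def [abs_def])
  then have "(\<lambda>n. S a (n - m) + S b (n - m)) \<longlonglongrightarrow> 0 + 0"
    using ab by (intro tendsto_add seq_offset_neg)
  then have lim: "(\<lambda>n. S a (n - m) + S b (n - m)) \<longlonglongrightarrow> 0" by simp
  show ?thesis
    by (rule tendsto_sandwich [OF _ _ tendsto_const lim])
      (use le in \<open>auto intro!: sum_nonneg always_eventually eventually_sequentiallyI [of m]\<close>)
qed

lemma distortion_eq:
  "distortion K n W p = (\<Sum>h\<in>hist K n. mprob K p n h * (\<Sum>g\<in>hist K n. pmf (W h) g * l1 K h g))"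
  unfolding distortion_def mprob_def by (simp add: sum_distrib_left mult.assoc)

text \<open>The bound on \<open>n\<close> is uniform over all mechanisms \<open>W\<close>, as the
  passage to the infimum requires.\<close>

lemma distortion_ge_noise_cost:
  fixes p :: "nat \<Rightarrow> real"
  assumes \<theta>: "0 < \<theta>" "\<theta> < 1" and p: "is_prob_vec K p" and \<epsilon>: "0 < \<epsilon>"
  shows "\<forall>\<^sub>F n in sequentially. \<forall>W. is_HSM K n W \<longrightarrow> is_DP K n \<theta> W \<longrightarrow>
    noise_cost K \<theta> - \<epsilon> \<le> distortion K n W p"
proof -
  define C where "C = noise_cost K \<theta>"
  have C: "0 \<le> C" using noise_cost_nonneg [OF \<theta>] by (simp add: C_def)
  \<comment> \<open>One half of \<epsilon> pays for the local cost bound, the other for boundary and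
    shift errors.\<close>
  define e where "e = \<epsilon> / 2"
  have e: "0 < e" using \<epsilon> by (simp add: e_def)
  obtain J :: nat where J: "C \<le> 2 * J"
    and local: "\<And>c. \<lbrakk>\<And>x. x \<in> lball K (2 * J) \<Longrightarrow> 0 \<le> c x;
       \<And>x y. \<lbrakk>x \<in> lball K (2 * J); y \<in> lball K (2 * J)\<rbrakk> \<Longrightarrow> sqrt \<theta> ^ nrm K (x - y) * c y \<le> c x\<rbrakk>
     \<Longrightarrow> 0 \<le> (\<Sum>x\<in>lball K (2 * J). c x * (real (nrm K x) - C + e))"
    unfolding C_def using local_noise_cost [OF \<theta> e] by blast
  define N where "N = 2 * J"
  define D where "D = N + C + e"
  define \<omega> where "\<omega> x = real (nrm K x) - C + e" for x
  have \<omega>_le: "\<bar>\<omega> x\<bar> \<le> D" if "x \<in> lball K N" for x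
    using that C e by (auto simp: \<omega>_def D_def lball_def)
  \<comment> \<open>The bound is \<open>2 * N\<close> because a histogram at distance less than
    \<open>N\<close> from one with an entry below \<open>N\<close> has an entry below
    \<open>2 * N\<close>.\<close>
  define \<tau> where "\<tau> n = (\<Sum>h\<in>{h \<in> hist K n. \<exists>k<K. h k < 2 * N}. mprob K p n h)" for n
  define \<Delta> where "\<Delta> x n = (\<Sum>g\<in>{g \<in> hist K n. \<forall>k<K. x k \<le> int (g k)}.
    \<bar>mprob K p n (hsub g x) - mprob K p n g\<bar>)" for x n
  have "\<tau> \<longlonglongrightarrow> 0"
    unfolding \<tau>_def [abs_def] by (intro mprob_small_coordinate [OF p] lim_const_over_n)
  moreover have "\<Delta> x \<longlonglongrightarrow> 0" if "x \<in> lball K N" for x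
    unfolding \<Delta>_def [abs_def] using that by (intro mprob_lattice_shift [OF p]) (auto simp: lball_def)
  ultimately have "(\<lambda>n. C * \<tau> n + D * (\<Sum>x\<in>lball K N. \<Delta> x n)) \<longlonglongrightarrow>
      C * 0 + D * (\<Sum>x\<in>lball K N. 0)"
    by (intro tendsto_intros)
  then have "\<forall>\<^sub>F n in sequentially. C * \<tau> n + D * (\<Sum>x\<in>lball K N. \<Delta> x n) < e"
    using e by (intro order_tendstoD(2)) auto
  then show ?thesis
  proof (eventually_elim, intro allI impI)
    fix n W
    assume small: "C * \<tau> n + D * (\<Sum>x\<in>lball K N. \<Delta> x n) < e"
      and HSM: "is_HSM K n W" and DP: "is_DP K n \<theta> W"
    let ?q = "mprob K p n"
    have q: "0 \<le> ?q h" for h by (rule mprob_nonneg [OF p])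
    have W1: "(\<Sum>g\<in>hist K n. pmf (W h) g) = 1" if "h \<in> hist K n" for h
      using HSM that by (intro sum_pmf_eq_1) (auto simp: is_HSM_def)
    \<comment> \<open>Weighted excess over \<open>C - e\<close>; as weights and rows of
      \<open>W\<close> have sum 1, its total is the distortion minus \<open>C - e\<close>.
      \<open>G\<close> collects the outputs around which the whole ball of radius \<open>N\<close>
      fits.\<close>
    define t where "t h g = ?q h * pmf (W h) g * (l1 K h g - C + e)" for h g
    define G where "G = {g \<in> hist K n. \<forall>k<K. N \<le> g k}"
    define H where "H g = {h \<in> hist K n. nrm K (emb h - emb g) < N}" for g
    define bad where "bad h \<longleftrightarrow> (\<exists>k<K. h k < 2 * N)" for h
    have "distortion K n W p - C + e = (\<Sum>h\<in>hist K n. \<Sum>g\<in>hist K n. t h g)"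
    proof -
      have "(\<Sum>g\<in>hist K n. t h g) =
          ?q h * (\<Sum>g\<in>hist K n. pmf (W h) g * l1 K h g) + (e - C) * ?q h" if "h \<in> hist K n" for h
      proof -
        have "(\<Sum>g\<in>hist K n. t h g) = (\<Sum>g\<in>hist K n. ?q h * (pmf (W h) g * l1 K h g)
            + (e - C) * ?q h * pmf (W h) g)"
          unfolding t_def by (intro sum.cong) (auto simp: algebra_simps)
        then show ?thesis
          using W1 [OF that] by (simp add: sum.distrib flip: sum_distrib_left)
      qed
      then show ?thesis
        using sum_mprob [OF p, of n]
        by (simp add: distortion_eq sum.distrib flip: sum_distrib_left)
    qed
    also have "\<dots> \<ge> (\<Sum>h\<in>hist K n. \<Sum>g\<in>hist K n.
        (if g \<in> G \<and> h \<in> H g then t h g else 0) - (if bad h then C * (?q h * pmf (W h) g) else 0))"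
    proof (intro sum_mono)
      fix h g assume h: "h \<in> hist K n" and g: "g \<in> hist K n"
      have qW: "0 \<le> ?q h * pmf (W h) g" using q by simp
      have CqW: "0 \<le> C * (?q h * pmf (W h) g)" using C qW by (rule mult_nonneg_nonneg)
      \<comment> \<open>Distant pairs have nonnegative excess and are dropped, near pairs with
        interior \<open>g\<close> are kept, and near pairs at the boundary lose at most
        \<open>C\<close> times their weight, charged to the bad \<open>h\<close>.\<close>
      consider "N \<le> nrm K (emb h - emb g)" | "h \<in> H g" "g \<in> G" | "h \<in> H g" "g \<notin> G"
        using h by (cases "N \<le> nrm K (emb h - emb g)"; cases "g \<in> G") (auto simp: H_def)
      then show "(if g \<in> G \<and> h \<in> H g then t h g else 0) -
          (if bad h then C * (?q h * pmf (W h) g) else 0) \<le> t h g"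
      proof cases
        case 1
        then have "C \<le> l1 K h g"
          using J unfolding l1_eq_nrm N_def by (meson of_nat_mono order_trans of_nat_le_iff)
        then have "0 \<le> t h g"
          unfolding t_def using e by (intro mult_nonneg_nonneg [OF qW]) auto
        then show ?thesis using 1 CqW by (auto simp: H_def)
      next
        case 2
        then show ?thesis using CqW by auto
      next
        case 3
        then obtain k where k: "k < K" "g k < N"
          using g by (auto simp: G_def not_le)
        have "\<bar>int (h k) - int (g k)\<bar> < int N"
          using abs_le_nrm [OF k(1), of "emb h - emb g"] 3(1) by (simp add: H_def)
        then have "bad h"
          using k unfolding bad_def by (intro exI [of _ k]) auto
        moreover have "- C * (?q h * pmf (W h) g) \<le> t h g"
        proof -
          have "?q h * pmf (W h) g * (- C) \<le> ?q h * pmf (W h) g * (l1 K h g - C + e)"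
            using qW e by (intro mult_left_mono) (auto simp: l1_eq_nrm)
          then show ?thesis by (simp add: t_def mult_ac)
        qed
        ultimately show ?thesis using 3 by auto
      qed
    qed
    also have "(\<Sum>h\<in>hist K n. \<Sum>g\<in>hist K n.
        (if g \<in> G \<and> h \<in> H g then t h g else 0) - (if bad h then C * (?q h * pmf (W h) g) else 0)) =
        (\<Sum>g\<in>G. \<Sum>h\<in>H g. t h g) - C * \<tau> n"
    proof -
      have "(\<Sum>h\<in>hist K n. \<Sum>g\<in>hist K n. if g \<in> G \<and> h \<in> H g then t h g else 0) =
          (\<Sum>g\<in>hist K n. \<Sum>h\<in>hist K n. if g \<in> G \<and> h \<in> H g then t h g else 0)"
        by (rule sum.swap)
      also have "\<dots> = (\<Sum>g\<in>hist K n. if g \<in> G then (\<Sum>h\<in>H g. t h g) else 0)"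
        by (intro sum.cong) (auto simp: sum.If_cases H_def Int_def intro!: sum.cong)
      also have "\<dots> = (\<Sum>g\<in>G. \<Sum>h\<in>H g. t h g)"
        by (auto simp: sum.If_cases G_def Int_def intro!: sum.cong)
      finally have 1: "(\<Sum>h\<in>hist K n. \<Sum>g\<in>hist K n. if g \<in> G \<and> h \<in> H g then t h g else 0) =
          (\<Sum>g\<in>G. \<Sum>h\<in>H g. t h g)" .
      have "(\<Sum>h\<in>hist K n. \<Sum>g\<in>hist K n. if bad h then C * (?q h * pmf (W h) g) else 0) =
          (\<Sum>h\<in>hist K n. if bad h then C * ?q h else 0)"
        using W1 by (intro sum.cong) (auto simp flip: sum_distrib_left mult.assoc)
      also have "\<dots> = C * \<tau> n"
        by (simp add: sum.If_cases \<tau>_def bad_def Int_def sum_distrib_left)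
      finally show ?thesis
        using 1 by (simp add: sum_subtractf)
    qed
    finally have main: "(\<Sum>g\<in>G. \<Sum>h\<in>H g. t h g) - C * \<tau> n \<le> distortion K n W p - C + e" .
    have "(\<Sum>g\<in>G. \<Sum>h\<in>H g. t h g) \<ge> (\<Sum>g\<in>G. - (D * (\<Sum>x\<in>lball K N. \<bar>?q (hsub g x) - ?q g\<bar>)))"
    proof (rule sum_mono)
      fix g assume "g \<in> G"
      then have g: "g \<in> hist K n" "\<And>k. k < K \<Longrightarrow> N \<le> g k" by (auto simp: G_def)
      have xg: "x k \<le> int (g k)" if "x \<in> lball K N" "k < K" for x k
        using abs_le_nrm [OF that(2), of x] that g(2) [OF that(2)] by (auto simp: lball_def)
      have emb_x: "emb (hsub g x) = emb g - x" and hsub_x: "hsub g x \<in> hist K n"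
        if "x \<in> lball K N" for x
        using that xg [OF that] g(1) by (auto intro!: emb_hsub hsub_in_hist simp: lball_def)
      define c where "c x = pmf (W (hsub g x)) g" for x
      \<comment> \<open>Recentring the column at \<open>g\<close> by \<open>x = g - h\<close>; since
        \<open>g\<close> is interior, every point of the ball occurs.\<close>
      have "(\<Sum>h\<in>H g. t h g) = (\<Sum>x\<in>lball K N. t (hsub g x) g)"
      proof (rule sum.reindex_bij_witness [where i = "hsub g" and j = "\<lambda>h. emb g - emb h"])
        fix h assume h: "h \<in> H g"
        then show "hsub g (emb g - emb h) = h"
          by (auto simp: hsub_def)
        then show "t (hsub g (emb g - emb h)) g = t h g" by simp
        show "emb g - emb h \<in> lball K N"
          using h g hist_diff_lattice [of g K n h] by (auto simp: H_def lball_def nrm_diff_commute)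
      next
        fix x assume x: "x \<in> lball K N"
        show "emb g - emb (hsub g x) = x"
          unfolding emb_x [OF x] by (auto simp: fun_eq_iff)
        then show "hsub g x \<in> H g"
          using hsub_x [OF x] x by (simp add: H_def lball_def nrm_diff_commute [of K "emb (hsub g x)"])
      qed
      also have "\<dots> = (\<Sum>x\<in>lball K N. ?q (hsub g x) * (c x * \<omega> x))"
      proof (rule sum.cong)
        fix x assume x: "x \<in> lball K N"
        have "emb g - emb (hsub g x) = x"
          unfolding emb_x [OF x] by (auto simp: fun_eq_iff)
        then have "l1 K (hsub g x) g = nrm K x"
          unfolding l1_eq_nrm by (simp add: nrm_diff_commute [of K "emb (hsub g x)"])
        then show "t (hsub g x) g = ?q (hsub g x) * (c x * \<omega> x)"
          by (simp add: t_def c_def \<omega>_def)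
      qed auto
      \<comment> \<open>Replacing the weight of \<open>g - x\<close> by that of \<open>g\<close>
        lets the weight be factored out; the price is controlled by asymptotic shift
        invariance.\<close>
      also have "\<dots> \<ge> (\<Sum>x\<in>lball K N. ?q g * (c x * \<omega> x) - D * \<bar>?q (hsub g x) - ?q g\<bar>)"
      proof (rule sum_mono)
        fix x assume x: "x \<in> lball K N"
        have "\<bar>c x * \<omega> x\<bar> \<le> 1 * D"
          unfolding abs_mult using \<omega>_le [OF x] by (intro mult_mono) (auto simp: c_def pmf_le_1)
        then have "\<bar>(?q (hsub g x) - ?q g) * (c x * \<omega> x)\<bar> \<le> \<bar>?q (hsub g x) - ?q g\<bar> * D"
          unfolding abs_mult [of "?q (hsub g x) - ?q g"] by (intro mult_left_mono) auto
        then show "?q g * (c x * \<omega> x) - D * \<bar>?q (hsub g x) - ?q g\<bar> \<le> ?q (hsub g x) * (c x * \<omega> x)"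
          by (simp add: abs_le_iff left_diff_distrib mult.commute [of D])
      qed
      also have "(\<Sum>x\<in>lball K N. ?q g * (c x * \<omega> x) - D * \<bar>?q (hsub g x) - ?q g\<bar>) =
          ?q g * (\<Sum>x\<in>lball K N. c x * \<omega> x) - D * (\<Sum>x\<in>lball K N. \<bar>?q (hsub g x) - ?q g\<bar>)"
        by (simp add: sum_subtractf sum_distrib_left)
      also have "\<dots> \<ge> - (D * (\<Sum>x\<in>lball K N. \<bar>?q (hsub g x) - ?q g\<bar>))"
      proof -
        \<comment> \<open>The inputs \<open>g - x\<close> and \<open>g - y\<close> differ by
          \<open>y - x\<close>, so \<open>DP_global\<close> is exactly the hypothesis of the local
          cost bound.\<close>
        have "0 \<le> (\<Sum>x\<in>lball K N. c x * \<omega> x)"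
          unfolding \<omega>_def N_def
        proof (rule local)
          fix x y assume "x \<in> lball K (2 * J)" "y \<in> lball K (2 * J)"
          then have xy: "x \<in> lball K N" "y \<in> lball K N" by (auto simp: N_def)
          have "emb (hsub g x) - emb (hsub g y) = y - x"
            unfolding emb_x [OF xy(1)] emb_x [OF xy(2)] by (auto simp: fun_eq_iff)
          then show "sqrt \<theta> ^ nrm K (x - y) * c y \<le> c x"
            using DP_global [OF DP \<theta>(1) hsub_x [OF xy(2)] hsub_x [OF xy(1)], of g]
            by (simp add: c_def nrm_diff_commute)
        qed (simp add: c_def)
        then show ?thesis using q [of g] by simp
      qed
      finally show "- (D * (\<Sum>x\<in>lball K N. \<bar>?q (hsub g x) - ?q g\<bar>)) \<le> (\<Sum>h\<in>H g. t h g)" .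
    qed
    also have "(\<Sum>g\<in>G. - (D * (\<Sum>x\<in>lball K N. \<bar>?q (hsub g x) - ?q g\<bar>))) =
        - (D * (\<Sum>x\<in>lball K N. \<Sum>g\<in>G. \<bar>?q (hsub g x) - ?q g\<bar>))"
      by (subst sum.swap) (simp add: sum_distrib_left sum_negf)
    also have "\<dots> \<ge> - (D * (\<Sum>x\<in>lball K N. \<Delta> x n))"
    proof -
      have "(\<Sum>g\<in>G. \<bar>?q (hsub g x) - ?q g\<bar>) \<le> \<Delta> x n" if x: "x \<in> lball K N" for x
        unfolding \<Delta>_def
      proof (rule sum_mono2)
        show "G \<subseteq> {g \<in> hist K n. \<forall>k<K. x k \<le> int (g k)}"
        proof
          fix g assume g: "g \<in> G"
          have "x k \<le> int (g k)" if "k < K" for k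
            using abs_le_nrm [OF that, of x] x g that by (force simp: G_def lball_def)
          then show "g \<in> {g \<in> hist K n. \<forall>k<K. x k \<le> int (g k)}"
            using g by (auto simp: G_def)
        qed
      qed auto
      then show ?thesis
        using C e by (auto intro!: mult_left_mono sum_mono simp: D_def)
    qed
    finally show "noise_cost K \<theta> - \<epsilon> \<le> distortion K n W p"
      using main small by (simp add: C_def e_def)
  qed
qed

section \<open>Additive noise\<close>

text \<open>The index grows slowly enough for each row to have become small before it is
  used.\<close>

lemma diagonal_tendsto_zero:
  fixes a :: "nat \<Rightarrow> nat \<Rightarrow> real"
  assumes a: "\<And>m. a m \<longlonglongrightarrow> 0"
  obtains \<mu> where "filterlim \<mu> at_top sequentially" "(\<lambda>n. a (\<mu> n) n) \<longlonglongrightarrow> 0"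
proof -
  have "\<exists>N. \<forall>n\<ge>N. \<bar>a m n\<bar> < 1 / (real m + 1)" for m
    using LIMSEQ_D [OF a [of m], of "1 / (real m + 1)"] by auto
  then obtain N where N: "\<And>m n. N m \<le> n \<Longrightarrow> \<bar>a m n\<bar> < 1 / (real m + 1)"
    by metis
  \<comment> \<open>Rows whose threshold has been passed at \<open>n\<close>, capped at
    \<open>n\<close> for finiteness; nonempty once \<open>N 0 \<le> n\<close>.\<close>
  define I where "I n = {m. m \<le> n \<and> N m \<le> n}" for n
  define \<mu> where "\<mu> n = Max (I n)" for n
  have fin: "finite (I n)" for n by (simp add: I_def)
  have "M \<le> \<mu> n" if "max M (N M) \<le> n" for M n
    unfolding \<mu>_def using that fin by (intro Max_ge) (auto simp: I_def)
  then have \<mu>: "filterlim \<mu> at_top sequentially"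
    unfolding filterlim_at_top eventually_sequentially by blast
  have "\<mu> n \<in> I n" if "N 0 \<le> n" for n
    unfolding \<mu>_def using fin that by (intro Max_in) (auto simp: I_def)
  then have "\<bar>a (\<mu> n) n\<bar> \<le> 1 / (real (\<mu> n) + 1)" if "N 0 \<le> n" for n
    using N that by (intro less_imp_le) (auto simp: I_def)
  then have le: "\<forall>\<^sub>F n in sequentially. norm (a (\<mu> n) n) \<le> 1 / (real (\<mu> n) + 1)"
    by (auto intro: eventually_sequentiallyI [of "N 0"])
  have "(\<lambda>m. 1 / (real m + 1)) \<longlonglongrightarrow> 0"
    by real_asymp
  then have "(\<lambda>n. 1 / (real (\<mu> n) + 1)) \<longlonglongrightarrow> 0"
    using \<mu> by (rule filterlim_compose)
  with le have "(\<lambda>n. a (\<mu> n) n) \<longlonglongrightarrow> 0"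
    by (rule Lim_null_comparison)
  with \<mu> show thesis by (rule that)
qed

lemma tendsto_expectation_tail:
  fixes f :: "'a \<Rightarrow> nat" and T :: "nat \<Rightarrow> nat"
  assumes f: "integrable (measure_pmf N) (\<lambda>x. real (f x))" and T: "filterlim T at_top sequentially"
  shows "(\<lambda>n. measure_pmf.expectation N (\<lambda>x. if T n \<le> f x then real (f x) else 0)) \<longlonglongrightarrow> 0"
proof -
  have "(\<lambda>n. measure_pmf.expectation N (\<lambda>x. if T n \<le> f x then real (f x) else 0))
      \<longlonglongrightarrow> measure_pmf.expectation N (\<lambda>x. 0)"
  proof (rule integral_dominated_convergence [where w = "\<lambda>x. real (f x)"])
    show "AE x in measure_pmf N. (\<lambda>n. if T n \<le> f x then real (f x) else 0) \<longlonglongrightarrow> 0"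
    proof (rule AE_I2)
      fix x
      have "\<forall>\<^sub>F n in sequentially. f x < T n"
        using T [unfolded filterlim_at_top, rule_format, of "Suc (f x)"] by (simp add: Suc_le_eq)
      then have "\<forall>\<^sub>F n in sequentially. (if T n \<le> f x then real (f x) else 0) = 0"
        by eventually_elim simp
      then show "(\<lambda>n. if T n \<le> f x then real (f x) else 0) \<longlonglongrightarrow> 0"
        by (rule tendsto_eventually)
    qed
  qed (use f in auto)
  then show ?thesis by simp
qed

text \<open>The tail condition makes the choice of noises uniform in \<open>p\<close>.\<close>

lemma near_optimal_noise:
  fixes T :: "nat \<Rightarrow> nat"
  assumes \<theta>: "0 < \<theta>" "\<theta> < 1" and T: "filterlim T at_top sequentially"
  obtains N where "\<And>n. N n \<in> noise K \<theta>"
    "(\<lambda>n. measure_pmf.expectation (N n) (\<lambda>x. real (nrm K x))) \<longlonglongrightarrow> noise_cost K \<theta>"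
    "(\<lambda>n. measure_pmf.expectation (N n) (\<lambda>x. if T n \<le> nrm K x then real (nrm K x) else 0)) \<longlonglongrightarrow> 0"
proof -
  let ?E = "\<lambda>N. measure_pmf.expectation N (\<lambda>x. real (nrm K x))"
  \<comment> \<open>The infimum need not be known to be attained; a minimising sequence is
    enough.\<close>
  have "\<exists>N\<in>noise K \<theta>. ?E N < noise_cost K \<theta> + 1 / (real m + 1)" for m
  proof -
    have "Inf (?E ` noise K \<theta>) < noise_cost K \<theta> + 1 / (real m + 1)"
      by (simp add: noise_cost_def)
    then show ?thesis
      using noise_nonempty [OF \<theta>, of K] by (auto dest!: cInf_lessD [rotated])
  qed
  then obtain M where M: "\<And>m. M m \<in> noise K \<theta>" "\<And>m. ?E (M m) < noise_cost K \<theta> + 1 / (real m + 1)"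
    by metis
  define a where "a m n = measure_pmf.expectation (M m) (\<lambda>x. if T n \<le> nrm K x then real (nrm K x) else 0)"
    for m n
  have "a m \<longlonglongrightarrow> 0" for m
    unfolding a_def [abs_def] using M(1) T by (intro tendsto_expectation_tail) (auto simp: noise_def)
  then obtain \<mu> where \<mu>: "filterlim \<mu> at_top sequentially" "(\<lambda>n. a (\<mu> n) n) \<longlonglongrightarrow> 0"
    using diagonal_tendsto_zero by blast
  have lim: "(\<lambda>m. noise_cost K \<theta> + 1 / (real m + 1)) \<longlonglongrightarrow> noise_cost K \<theta>"
    by real_asymp
  have "(\<lambda>m. ?E (M m)) \<longlonglongrightarrow> noise_cost K \<theta>"
    by (rule tendsto_sandwich [OF always_eventually always_eventually tendsto_const lim])
      (intro allI noise_cost_le M less_imp_le [OF M(2)])+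
  then have "(\<lambda>n. ?E (M (\<mu> n))) \<longlonglongrightarrow> noise_cost K \<theta>"
    using \<mu>(1) by (rule filterlim_compose)
  with M(1) \<mu>(2) show thesis
    by (intro that [of "\<lambda>n. M (\<mu> n)"]) (auto simp: a_def)
qed

text \<open>Post-processing. A value of the mapped pmf is the measure of a possibly infinite fibre,
  so the pointwise inequality is first lifted to all sets.\<close>

lemma pmf_map_mono:
  assumes \<theta>: "0 \<le> \<theta>" and le: "\<And>b. \<theta> * pmf M b \<le> pmf M' b"
  shows "\<theta> * pmf (map_pmf F M) c \<le> pmf (map_pmf F M') c"
proof -
  have "ennreal \<theta> * emeasure (measure_pmf M) A \<le> emeasure (measure_pmf M') A" for A
  proof -
    have "ennreal \<theta> * emeasure (measure_pmf M) A = (\<integral>\<^sup>+ x. ennreal \<theta> * ennreal (pmf M x) \<partial>count_space A)"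
      by (subst nn_integral_cmult) (auto simp: nn_integral_pmf)
    also have "\<dots> \<le> (\<integral>\<^sup>+ x. ennreal (pmf M' x) \<partial>count_space A)"
      using le \<theta> by (intro nn_integral_mono) (simp flip: ennreal_mult' add: ennreal_leI)
    finally show ?thesis by (simp add: nn_integral_pmf)
  qed
  then show ?thesis
    using \<theta> by (simp add: pmf_map measure_pmf.emeasure_eq_measure flip: ennreal_mult')
qed

lemma neighboring_commute: "neighboring K h g \<longleftrightarrow> neighboring K g h"
  by (simp add: neighboring_def l1_def abs_minus_commute)

lemma is_DPI:
  assumes "0 < \<theta>"
    and "\<And>h g b. \<lbrakk>h \<in> hist K n; g \<in> hist K n; neighboring K h g\<rbrakk> \<Longrightarrow> \<theta> * pmf (M h) b \<le> pmf (M g) b"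
  shows "is_DP K n \<theta> M"
  unfolding is_DP_def
proof (intro ballI impI allI)
  fix h g b assume h: "h \<in> hist K n" "g \<in> hist K n" "neighboring K h g"
  have "\<theta> * pmf (M g) b \<le> pmf (M h) b"
    using assms(2) [of g h b] h neighboring_commute by blast
  then show "\<theta> * pmf (M h) b \<le> pmf (M g) b \<and> pmf (M g) b \<le> pmf (M h) b / \<theta>"
    using assms(1) assms(2) [OF h, of b] by (simp add: field_simps)
qed

lemma is_DP_map_pmf:
  assumes "0 < \<theta>" "is_DP K n \<theta> M"
  shows "is_DP K n \<theta> (\<lambda>h. map_pmf F (M h))"
  using assms by (intro is_DPI pmf_map_mono) (auto simp: is_DP_def)

section \<open>Correction to a histogram and the additive mechanism\<close>

definition hproj :: "nat \<Rightarrow> nat \<Rightarrow> (nat \<Rightarrow> int) \<Rightarrow> nat \<Rightarrow> nat" where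
  "hproj K n b = (SOME g. g \<in> hist K n \<and> (\<forall>h\<in>hist K n. nrm K (emb g - emb h) \<le> 2 * nrm K (b - emb h)))"

text \<open>A nearest histogram has the required property by the triangle inequality. The factor 2
  also forces a histogram to be sent to itself.\<close>

lemma hproj:
  assumes "0 < K"
  shows "hproj K n b \<in> hist K n"
    and "h \<in> hist K n \<Longrightarrow> nrm K (emb (hproj K n b) - emb h) \<le> 2 * nrm K (b - emb h)"
proof -
  have "(\<lambda>k. if k = 0 then n else 0) \<in> hist K n"
    using assms by (auto simp: hist_def)
  from ex_has_least_nat [of "\<lambda>g. g \<in> hist K n", OF this, of "\<lambda>g. nrm K (b - emb g)"]
  obtain g where g: "g \<in> hist K n" "\<And>h. h \<in> hist K n \<Longrightarrow> nrm K (b - emb g) \<le> nrm K (b - emb h)"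
    by auto
  have "nrm K (emb g - emb h) \<le> 2 * nrm K (b - emb h)" if "h \<in> hist K n" for h
    using nrm_triangle [of K "emb g" "emb h" b] g(2) [OF that] by (simp add: nrm_diff_commute)
  with g(1) have ex: "\<exists>g. g \<in> hist K n \<and> (\<forall>h\<in>hist K n. nrm K (emb g - emb h) \<le> 2 * nrm K (b - emb h))"
    by blast
  from someI_ex [OF ex] show "hproj K n b \<in> hist K n"
    and "h \<in> hist K n \<Longrightarrow> nrm K (emb (hproj K n b) - emb h) \<le> 2 * nrm K (b - emb h)"
    unfolding hproj_def by blast+
qed

text \<open>Addition of functions is not available as \<open>+\<close>, hence \<open>x - (- emb h)\<close> for
  \<open>emb h + x\<close>.\<close>

definition additive_HSM :: "nat \<Rightarrow> nat \<Rightarrow> (nat \<Rightarrow> int) pmf \<Rightarrow> (nat \<Rightarrow> nat) \<Rightarrow> (nat \<Rightarrow> nat) pmf" where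
  "additive_HSM K n N h = map_pmf (\<lambda>x. hproj K n (x - (- emb h))) N"

lemma is_HSM_additive_HSM: "0 < K \<Longrightarrow> is_HSM K n (additive_HSM K n N)"
  by (auto simp: is_HSM_def additive_HSM_def hproj(1))

text \<open>Before the correction, output \<open>b\<close> has probability
  \<open>pmf N (b - emb h)\<close>, and neighbouring inputs shift the argument by a root. The
  correction is post-processing.\<close>

lemma is_DP_additive_HSM:
  assumes \<theta>: "0 < \<theta>" and N: "N \<in> noise K \<theta>"
  shows "is_DP K n \<theta> (additive_HSM K n N)"
proof -
  define M where "M h = map_pmf (\<lambda>x. x - (- emb h)) N" for h
  have additive_eq: "additive_HSM K n N h = map_pmf (hproj K n) (M h)" for h
    by (simp add: additive_HSM_def M_def map_pmf_comp)
  have pmf_M: "pmf (M h) b = pmf N (b - emb h)" for h b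
  proof -
    have "inj (\<lambda>x. x - (- emb h))"
      by (auto simp: inj_def fun_eq_iff)
    from pmf_map_inj' [OF this, of N "b - emb h"] show ?thesis
      by (simp add: M_def fun_diff_def)
  qed
  have "is_DP K n \<theta> M"
  proof (rule is_DPI [OF \<theta>])
    fix h g b assume h: "h \<in> hist K n" "g \<in> hist K n" and nb: "neighboring K h g"
    have nb': "nrm K (b - emb h - (b - emb g)) = 2"
    proof -
      have "b - emb h - (b - emb g) = emb g - emb h" by auto
      then show ?thesis
        using nb by (simp add: neighboring_def l1_eq_nrm nrm_diff_commute)
    qed
    show "\<theta> * pmf (M h) b \<le> pmf (M g) b"
    proof (cases "b - emb h \<in> root_lattice K")
      case True
      have "b - emb g = b - emb h - (emb g - emb h)" by auto
      then have "b - emb g \<in> root_lattice K"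
        using root_lattice_diff [OF True hist_diff_lattice [OF h(2,1)]] by simp
      with True nb' N show ?thesis
        by (auto simp: pmf_M noise_def)
    next
      case False
      then have "pmf N (b - emb h) = 0"
        using N by (auto simp: noise_def set_pmf_iff)
      then show ?thesis by (simp add: pmf_M)
    qed
  qed
  then show ?thesis
    unfolding additive_eq [abs_def] by (rule is_DP_map_pmf [OF \<theta>])
qed

text \<open>Noise of norm below \<open>T\<close> added to a histogram with all entries at least
  \<open>T\<close> needs no correction and costs its norm. Otherwise the cost is at most twice the
  norm, the excess being charged to the tail or to the small entries.\<close>

lemma distortion_additive_HSM_le:
  fixes p :: "nat \<Rightarrow> real"
  assumes K: "0 < K" and p: "is_prob_vec K p" and N: "N \<in> noise K \<theta>"
  defines "E \<equiv> measure_pmf.expectation N (\<lambda>x. real (nrm K x))"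
  shows "distortion K n (additive_HSM K n N) p \<le> E
    + measure_pmf.expectation N (\<lambda>x. if T \<le> nrm K x then real (nrm K x) else 0)
    + E * (\<Sum>h\<in>{h \<in> hist K n. \<exists>k<K. h k < T}. mprob K p n h)"
proof -
  define R where "R = measure_pmf.expectation N (\<lambda>x. if T \<le> nrm K x then real (nrm K x) else 0)"
  have int: "integrable (measure_pmf N) (\<lambda>x. real (nrm K x))"
    and NL: "set_pmf N \<subseteq> root_lattice K"
    using N by (auto simp: noise_def)
  have intR: "integrable (measure_pmf N) (\<lambda>x. if T \<le> nrm K x then real (nrm K x) else 0)"
    by (rule Bochner_Integration.integrable_bound [OF int]) auto
  define bad where "bad h \<longleftrightarrow> (\<exists>k<K. h k < T)" for h
  have per_h: "(\<Sum>g\<in>hist K n. pmf (additive_HSM K n N h) g * l1 K h g) \<le> E + R + (if bad h then E else 0)"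
    if h: "h \<in> hist K n" for h
  proof -
    let ?Y = "\<lambda>x. l1 K h (hproj K n (x - (- emb h)))"
    have Y: "?Y x = nrm K (emb (hproj K n (x - (- emb h))) - emb h)" for x
      by (simp add: l1_eq_nrm nrm_diff_commute)
    have shift: "x - (- emb h) - emb h = x" for x
      by auto
    have Y2: "?Y x \<le> 2 * real (nrm K x)" for x
      using hproj(2) [OF K h, of "x - (- emb h)"] unfolding Y shift by linarith
    have Y1: "?Y x \<le> real (nrm K x)" if x: "x \<in> root_lattice K" "nrm K x < T" "\<not> bad h" for x
    proof -
      define y where "y = - x"
      have y: "y \<in> root_lattice K"
        using x(1) by (auto simp: y_def root_lattice_def sum_negf)
      have yh: "y k \<le> int (h k)" if "k < K" for k
        using abs_le_nrm [OF that, of x] x(2,3) that by (force simp: y_def bad_def)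
      define g where "g = hsub h y"
      have g: "g \<in> hist K n" "emb g = emb h - y"
        using hsub_in_hist [OF h y yh] emb_hsub [OF h y yh] by (auto simp: g_def)
      \<comment> \<open>The noisy vector is itself the histogram \<open>g\<close>, so the correction
        has distance 0 from it.\<close>
      have "x - (- emb h) - emb g = (\<lambda>_. 0)" "emb g - emb h = x"
        by (auto simp: g(2) y_def)
      then show ?thesis
        using hproj(2) [OF K g(1), of "x - (- emb h)"]
          nrm_triangle [of K "emb (hproj K n (x - (- emb h)))" "emb h" "emb g"]
        unfolding Y by simp
    qed
    have intY: "integrable (measure_pmf N) ?Y"
      by (rule Bochner_Integration.integrable_bound [OF integrable_mult_right [OF int, of 2]])
        (use Y2 Y in \<open>auto\<close>)
    have "(\<Sum>g\<in>hist K n. pmf (additive_HSM K n N h) g * l1 K h g) =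
        measure_pmf.expectation (additive_HSM K n N h) (l1 K h)"
      using is_HSM_additive_HSM [OF K, of n N] h
      by (subst integral_measure_pmf_real [of "hist K n"]) (auto simp: is_HSM_def mult.commute)
    also have "\<dots> = measure_pmf.expectation N ?Y"
      by (simp add: additive_HSM_def)
    also have "\<dots> \<le> measure_pmf.expectation N (\<lambda>x. real (nrm K x) +
        (if T \<le> nrm K x then real (nrm K x) else 0) + (if bad h then real (nrm K x) else 0))"
    proof (rule integral_mono_AE [OF intY])
      show "AE x in measure_pmf N. ?Y x \<le> real (nrm K x) +
          (if T \<le> nrm K x then real (nrm K x) else 0) + (if bad h then real (nrm K x) else 0)"
        unfolding AE_measure_pmf_iff
      proof
        fix x assume "x \<in> set_pmf N"
        then show "?Y x \<le> real (nrm K x) +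
          (if T \<le> nrm K x then real (nrm K x) else 0) + (if bad h then real (nrm K x) else 0)"
          using Y1 [of x] Y2 [of x] NL by (cases "bad h"; cases "T \<le> nrm K x") auto
      qed
      show "integrable (measure_pmf N) (\<lambda>x. real (nrm K x) +
          (if T \<le> nrm K x then real (nrm K x) else 0) + (if bad h then real (nrm K x) else 0))"
        using int intR by (cases "bad h") auto
    qed
    also have "\<dots> = E + R + (if bad h then E else 0)"
      using int intR by (simp add: E_def R_def)
    finally show ?thesis .
  qed
  have "distortion K n (additive_HSM K n N) p \<le>
      (\<Sum>h\<in>hist K n. mprob K p n h * (E + R + (if bad h then E else 0)))"
    unfolding distortion_eq using per_h mprob_nonneg [OF p] by (intro sum_mono mult_left_mono) auto
  also have "\<dots> = (E + R) * (\<Sum>h\<in>hist K n. mprob K p n h)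
      + (\<Sum>h\<in>hist K n. if bad h then E * mprob K p n h else 0)"
    unfolding sum_distrib_left sum.distrib [symmetric] by (intro sum.cong) (auto simp: algebra_simps)
  also have "(\<Sum>h\<in>hist K n. if bad h then E * mprob K p n h else 0) =
      E * (\<Sum>h\<in>{h \<in> hist K n. \<exists>k<K. h k < T}. mprob K p n h)"
    by (simp add: sum.If_cases bad_def Int_def sum_distrib_left)
  finally show ?thesis
    by (simp add: sum_mprob [OF p] R_def)
qed

section \<open>Matching the two bounds\<close>

lemma opt_distortion_le:
  assumes "is_HSM K n W" "is_DP K n \<theta> W" and p: "is_prob_vec K p"
  shows "opt_distortion K n \<theta> p \<le> distortion K n W p"
proof -
  have "0 \<le> distortion K n W p" for W
    unfolding distortion_eq
    by (intro sum_nonneg mult_nonneg_nonneg mprob_nonneg [OF p]) (auto simp: l1_eq_nrm)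
  then have "bdd_below {distortion K n W p |W. is_HSM K n W \<and> is_DP K n \<theta> W}"
    by (intro bdd_belowI [of _ 0]) auto
  then show ?thesis
    unfolding opt_distortion_def using assms by (intro cInf_lower) auto
qed

lemma opt_distortion_ge:
  assumes "is_HSM K n W" "is_DP K n \<theta> W"
    and "\<And>W. is_HSM K n W \<Longrightarrow> is_DP K n \<theta> W \<Longrightarrow> c \<le> distortion K n W p"
  shows "c \<le> opt_distortion K n \<theta> p"
  unfolding opt_distortion_def using assms by (intro cInf_greatest) auto

text \<open>The mechanism is fixed before \<open>p\<close>; the probabilities enter only the error
  terms of its analysis.\<close>

lemma universal_HSM:
  assumes K: "0 < K" and \<theta>: "0 < \<theta>" "\<theta> < 1"
  obtains W where "\<And>n. is_HSM K n (W n)" "\<And>n. is_DP K n \<theta> (W n)"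
    "\<And>p. is_prob_vec K p \<Longrightarrow> (\<lambda>n. distortion K n (W n) p) \<longlonglongrightarrow> lim_opt_distortion K \<theta> p"
proof -
  \<comment> \<open>Must tend to infinity for the noise tails to vanish, yet be of smaller order
    than \<open>n\<close> for small entries to be rare.\<close>
  define T where "T n = nat \<lfloor>sqrt (real n)\<rfloor>" for n
  have "filterlim (\<lambda>n. real (T n)) at_top sequentially"
    unfolding T_def by real_asymp
  then have T: "filterlim T at_top sequentially"
    by (simp add: filterlim_sequentially_iff_filterlim_real)
  have "(\<lambda>n. sqrt (real n) / real n) \<longlonglongrightarrow> 0"
    by real_asymp
  then have T0: "(\<lambda>n. real (T n) / real n) \<longlonglongrightarrow> 0"
    by (rule tendsto_sandwich [OF _ _ tendsto_const, rotated 2])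
      (auto intro!: always_eventually divide_right_mono simp: T_def)
  obtain N where N: "\<And>n. N n \<in> noise K \<theta>"
    and E: "(\<lambda>n. measure_pmf.expectation (N n) (\<lambda>x. real (nrm K x))) \<longlonglongrightarrow> noise_cost K \<theta>"
    and R: "(\<lambda>n. measure_pmf.expectation (N n)
      (\<lambda>x. if T n \<le> nrm K x then real (nrm K x) else 0)) \<longlonglongrightarrow> 0"
    using near_optimal_noise [OF \<theta> T, of K] by blast
  define W where "W n = additive_HSM K n (N n)" for n
  have HSM: "is_HSM K n (W n)" and DP: "is_DP K n \<theta> (W n)" for n
    unfolding W_def using K \<theta> N by (auto intro!: is_HSM_additive_HSM is_DP_additive_HSM)
  have "(\<lambda>n. distortion K n (W n) p) \<longlonglongrightarrow> lim_opt_distortion K \<theta> p" if p: "is_prob_vec K p" for p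
  proof -
    define u where "u n = measure_pmf.expectation (N n) (\<lambda>x. real (nrm K x))
      + measure_pmf.expectation (N n) (\<lambda>x. if T n \<le> nrm K x then real (nrm K x) else 0)
      + measure_pmf.expectation (N n) (\<lambda>x. real (nrm K x))
        * (\<Sum>h\<in>{h \<in> hist K n. \<exists>k<K. h k < T n}. mprob K p n h)" for n
    have "u \<longlonglongrightarrow> noise_cost K \<theta> + 0 + noise_cost K \<theta> * 0"
      unfolding u_def [abs_def]
      by (intro tendsto_add tendsto_mult E R mprob_small_coordinate [OF p T0])
    then have u: "u \<longlonglongrightarrow> noise_cost K \<theta>" by simp
    have W_le: "distortion K n (W n) p \<le> u n" for n
      unfolding u_def W_def by (rule distortion_additive_HSM_le [OF K p N])
    \<comment> \<open>Used twice: for the optimal distortion, which also shows that its limit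
      exists, and for the distortion of the constructed mechanism.\<close>
    have squeeze: "d \<longlonglongrightarrow> noise_cost K \<theta>"
      if le: "\<And>n. d n \<le> u n"
        and ge: "\<And>n c. (\<And>W. is_HSM K n W \<Longrightarrow> is_DP K n \<theta> W \<Longrightarrow> c \<le> distortion K n W p) \<Longrightarrow> c \<le> d n"
      for d :: "nat \<Rightarrow> real"
    proof (rule order_tendstoI)
      fix a assume "a < noise_cost K \<theta>"
      then have "0 < (noise_cost K \<theta> - a) / 2" by simp
      from distortion_ge_noise_cost [OF \<theta> p this]
      show "\<forall>\<^sub>F n in sequentially. a < d n"
      proof eventually_elim
        case (elim n)
        then have "noise_cost K \<theta> - (noise_cost K \<theta> - a) / 2 \<le> d n"
          by (intro ge) auto
        then show ?case
          using \<open>a < noise_cost K \<theta>\<close> by (simp add: field_simps)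
      qed
    next
      fix a assume "noise_cost K \<theta> < a"
      with u have "\<forall>\<^sub>F n in sequentially. u n < a"
        by (rule order_tendstoD(2))
      then show "\<forall>\<^sub>F n in sequentially. d n < a"
        by eventually_elim (rule le_less_trans [OF le])
    qed
    have "(\<lambda>n. opt_distortion K n \<theta> p) \<longlonglongrightarrow> noise_cost K \<theta>"
      by (rule squeeze [OF order_trans [OF opt_distortion_le [OF HSM DP p] W_le]])
        (rule opt_distortion_ge [OF HSM DP])
    then have "lim_opt_distortion K \<theta> p = noise_cost K \<theta>"
      unfolding lim_opt_distortion_def by (rule limI)
    moreover have "(\<lambda>n. distortion K n (W n) p) \<longlonglongrightarrow> noise_cost K \<theta>"
      using HSM DP by (intro squeeze W_le) blast
    ultimately show ?thesis by simp
  qed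
  with HSM DP show thesis by (rule that)
qed

theorem theorem2:
  fixes K :: nat and \<theta> :: real
  assumes "K \<ge> 2" and "0 < \<theta>" and "\<theta> < 1"
  shows "\<exists>(E :: nat \<Rightarrow> nat set) (U :: nat \<Rightarrow> (nat \<Rightarrow> nat) \<Rightarrow> nat pmf).
           (\<forall>n. is_DP K n \<theta> (U n) \<and> (\<forall>h\<in>hist K n. set_pmf (U n h) \<subseteq> E n)) \<and>
           (\<forall>p. is_prob_vec K p \<longrightarrow>
              (\<exists>V :: nat \<Rightarrow> nat \<Rightarrow> (nat \<Rightarrow> nat) pmf.
                 (\<forall>n. \<forall>b\<in>E n. set_pmf (V n b) \<subseteq> hist K n) \<and>
                 (\<forall>n. is_HSM K n (\<lambda>h. bind_pmf (U n h) (V n)) \<and>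
                      is_DP K n \<theta> (\<lambda>h. bind_pmf (U n h) (V n))) \<and>
                 ((\<lambda>n. distortion K n (\<lambda>h. bind_pmf (U n h) (V n)) p)
                    \<longlonglongrightarrow> lim_opt_distortion K \<theta> p)))"
proof -
  obtain W where HSM: "\<And>n. is_HSM K n (W n)" and DP: "\<And>n. is_DP K n \<theta> (W n)"
    and lim: "\<And>p. is_prob_vec K p \<Longrightarrow> (\<lambda>n. distortion K n (W n) p) \<longlonglongrightarrow> lim_opt_distortion K \<theta> p"
    using universal_HSM [of K \<theta>] assms by auto
  \<comment> \<open>The extended set consists of natural numbers, so histograms are numbered.
    \<open>U\<close> already contains the whole mechanism, and \<open>V\<close> merely decodes, in
    the same way for every \<open>p\<close>.\<close>
  define code where "code n = to_nat_on (hist K n)" for n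
  define E where "E n = code n ` hist K n" for n
  define U where "U n h = map_pmf (code n) (W n h)" for n h
  define V where "V n b = return_pmf (inv_into (hist K n) (code n) b)" for n b
  have inj: "inj_on (code n) (hist K n)" for n
    unfolding code_def by (intro inj_on_to_nat_on countable_finite) simp
  have W_sub: "set_pmf (W n h) \<subseteq> hist K n" if "h \<in> hist K n" for n h
    using HSM that by (auto simp: is_HSM_def)
  \<comment> \<open>Agreement on \<open>hist K n\<close> suffices, since privacy, the HSM property
    and the distortion look only at inputs there.\<close>
  have decode: "bind_pmf (U n h) (V n) = W n h" if h: "h \<in> hist K n" for n h
  proof -
    have "bind_pmf (U n h) (V n) = map_pmf (\<lambda>g. inv_into (hist K n) (code n) (code n g)) (W n h)"
      by (simp add: U_def V_def [abs_def] map_pmf_comp flip: map_pmf_def)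
    also have "\<dots> = map_pmf (\<lambda>g. g) (W n h)"
      using inj W_sub [OF h] by (intro map_pmf_cong) (auto simp: inv_into_f_f)
    finally show ?thesis by simp
  qed
  have "is_DP K n \<theta> (U n)" for n
    unfolding U_def [abs_def] using assms(2) DP by (rule is_DP_map_pmf)
  moreover have "\<forall>h\<in>hist K n. set_pmf (U n h) \<subseteq> E n" for n
    using W_sub by (auto simp: U_def E_def)
  moreover have "\<exists>V :: nat \<Rightarrow> nat \<Rightarrow> (nat \<Rightarrow> nat) pmf.
      (\<forall>n. \<forall>b\<in>E n. set_pmf (V n b) \<subseteq> hist K n) \<and>
      (\<forall>n. is_HSM K n (\<lambda>h. bind_pmf (U n h) (V n)) \<and>
           is_DP K n \<theta> (\<lambda>h. bind_pmf (U n h) (V n))) \<and>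
      ((\<lambda>n. distortion K n (\<lambda>h. bind_pmf (U n h) (V n)) p) \<longlonglongrightarrow> lim_opt_distortion K \<theta> p)"
    if p: "is_prob_vec K p" for p
  proof (intro exI [of _ V] conjI allI)
    fix n
    show "\<forall>b\<in>E n. set_pmf (V n b) \<subseteq> hist K n"
      using inj by (auto simp: E_def V_def inv_into_f_f)
    show "is_HSM K n (\<lambda>h. bind_pmf (U n h) (V n))"
      using HSM [of n] unfolding is_HSM_def by (simp add: decode)
    show "is_DP K n \<theta> (\<lambda>h. bind_pmf (U n h) (V n))"
      using DP [of n] unfolding is_DP_def by (simp add: decode)
  next
    have "distortion K n (\<lambda>h. bind_pmf (U n h) (V n)) p = distortion K n (W n) p" for n
      unfolding distortion_eq by (intro sum.cong) (auto simp: decode)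
    then show "(\<lambda>n. distortion K n (\<lambda>h. bind_pmf (U n h) (V n)) p) \<longlonglongrightarrow> lim_opt_distortion K \<theta> p"
      using lim [OF p] by simp
  qed
  ultimately show ?thesis by blast
qed

end
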